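(* Let $a,b<0$ be integers. Then the non-commutative frieze subring $(a,b)_{\mathbb{Z}}^{\circ}$ of the Lipschitz quaternion ring $(a,b)_{\mathbb{Z}}$ is $$(a,b)_{\mathbb{Z}}^{\circ}=\begin{cases}\mathbb{Z} & \text{if } a\le-4 \text{ and } b\le-4,\\ (a,b)_{\mathbb{Z}} & \text{if } a\ge-3 \text{ and } b\ge-3,\\ \mathbb{Z}[\mathrm{i}] & \text{if } a\in\{-1,-2,-3\} \text{ and } b\le-4,\\ \mathbb{Z}[\mathrm{j}] & \text{if } a\le-4 \text{ and } b\in\{-1,-2,-3\}.\end{cases}$$
   Context: For non-zero integers $a,b$, the quaternion algebra $(a,b)_{\mathbb{Q}}$ is the 4-dimensional associative $\mathbb{Q}$-algebra with basis $1,\mathrm{i},\mathrm{j},\mathrm{k}$ and relations $\mathrm{i}^2=a$, $\mathrm{j}^2=b$, $\mathrm{i}\mathrm{j}=\mathrm{k}=-\mathrm{j}\mathrm{i}$. For $a,b<0$ it is a division ring. The Lipschitz subring (Lipschitz quaternion ring) is $(a,b)_{\mathbb{Z}}=\{\alpha+\beta\mathrm{i}+\gamma\mathrm{j}+\delta\mathrm{k} : \alpha,\beta,\gamma,\delta\in\mathbb{Z}\}$; $\mathbb{Z}[\mathrm{i}]=\{\alpha+\beta\mathrm{i}:\alpha,\beta\in\mathbb{Z}\}$ and $\mathbb{Z}[\mathrm{j}]=\{\alpha+\gamma\mathrm{j}:\alpha,\gamma\in\mathbb{Z}\}$ are subrings of it. Non-commutative friezes. Let $D$ be a division ring and let $\mathcal{P}$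 be an $m$-gon ($m\ge3$) with vertices $0,1,\dots,m-1$ in cyclic order (indices modulo $m$). Let $\mathrm{diag}(\mathcal{P})$ be the set of ordered pairs of distinct vertices (edges included, both orientations). A non-commutative frieze over $D$ on $\mathcal{P}$ is a map $c:\mathrm{diag}(\mathcal{P})\to D\setminus\{0\}$, $(r,s)\mapsto c_{r,s}$, satisfying: (a) for all $r$: $c_{r+1,r+2}c_{r,r+2}^{-1}c_{r,r+1}=c_{r+1,r}c_{r+2,r}^{-1}c_{r+2,r+1}$; (b) for all $r,s$ with $r,r+1,s,s+1$ pairwise distinct: $c_{s,r}=c_{s,s+1}c_{r+1,s+1}^{-1}c_{r+1,r}+c_{s,r+1}c_{s+1,r+1}^{-1}c_{s+1,r}$, $c_{r,s}=c_{r,r+1}c_{s+1,r+1}^{-1}c_{s+1,s}+c_{r,s+1}c_{r+1,s+1}^{-1}c_{r+1,s}$, $c_{r+1,s+1}=c_{r+1,r}c_{s,r}^{-1}c_{s,s+1}+c_{r+1,s}c_{r,s}^{-1}c_{r,s+1}$, $c_{s+1,r+1}=c_{s+1,s}c_{r,s}^{-1}c_{r,r+1}+c_{s+1,r}c_{s,r}^{-1}c_{s,r+1}$. The boundary entries are the $c_{r,r+1}$ and $c_{r+1,r}$. The non-commutative frieze subring $(a,b)_{\mathbb{Z}}^{\circ}$ is the subring of $(a,b)_{\mathbb{Z}}$ generated by all entries of all non-commutative friezes over the division ring $(a,b)_{\mathbb{Q}}$, on $m$-gons for all $m\ge3$, such that all entries lie in $(a,b)_{\mathbb{Z}}\setminus\{0\}$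 and all boundary entries equal $1$. *)

theory Defs
  imports Complex_Main "HOL-Algebra.Generated_Rings"
begin

section \<open>Quaternion algebras over the rationals\<close>

text \<open>\<open>Quat x y z w\<close> stands for \<open>x + y i + z j + w k\<close>.\<close>

datatype quat = Quat (qRe: rat) (qI: rat) (qJ: rat) (qK: rat)

text \<open>The product is the bilinear extension of the table that follows from
  \<open>i\<^sup>2 = a\<close>, \<open>j\<^sup>2 = b\<close> and \<open>i j = k = - j i\<close>, namely \<open>k\<^sup>2 = - a b\<close>, \<open>i k = a j = - k i\<close>
  and \<open>k j = b i = - j k\<close>.\<close>

definition quat_mult :: "int \<Rightarrow> int \<Rightarrow> quat \<Rightarrow> quat \<Rightarrow> quat" where
  "quat_mult a b p q =
     (let A = of_int a; B = of_int b in
      Quat (qRe p * qRe q + A * (qI p * qI q) + B * (qJ p * qJ q) - A * B * (qK p * qK q))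
           (qRe p * qI q + qI p * qRe q - B * (qJ p * qK q) + B * (qK p * qJ q))
           (qRe p * qJ q + qJ p * qRe q + A * (qI p * qK q) - A * (qK p * qI q))
           (qRe p * qK q + qK p * qRe q + qI p * qJ q - qJ p * qI q))"

definition quat_alg :: "int \<Rightarrow> int \<Rightarrow> quat ring" where
  "quat_alg a b =
     \<lparr>carrier = UNIV,
      mult = quat_mult a b,
      one = Quat 1 0 0 0,
      zero = Quat 0 0 0 0,
      add = \<lambda>p q. Quat (qRe p + qRe q) (qI p + qI q) (qJ p + qJ q) (qK p + qK q)\<rparr>"

lemmas quat_alg_simps = quat_alg_def quat_mult_def Let_def

lemma quat_alg_relations:
  fixes a b :: int
  defines "i \<equiv> Quat 0 1 0 0" and "j \<equiv> Quat 0 0 1 0" and "k \<equiv> Quat 0 0 0 1"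
  shows "i \<otimes>\<^bsub>quat_alg a b\<^esub> i = Quat (of_int a) 0 0 0"
    and "j \<otimes>\<^bsub>quat_alg a b\<^esub> j = Quat (of_int b) 0 0 0"
    and "i \<otimes>\<^bsub>quat_alg a b\<^esub> j = k"
    and "j \<otimes>\<^bsub>quat_alg a b\<^esub> i = Quat 0 0 0 (-1)"
  by (simp_all add: i_def j_def k_def quat_alg_simps)

lemma ring_quat_alg: "ring (quat_alg a b)"
proof (rule ringI)
  show "abelian_group (quat_alg a b)"
  proof (rule abelian_groupI)
    fix x assume "x \<in> carrier (quat_alg a b)"
    show "\<exists>y\<in>carrier (quat_alg a b). y \<oplus>\<^bsub>quat_alg a b\<^esub> x = \<zero>\<^bsub>quat_alg a b\<^esub>"
      by (intro bexI[of _ "Quat (- qRe x) (- qI x) (- qJ x) (- qK x)"])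
         (auto simp: quat_alg_simps)
  qed (auto simp: quat_alg_simps algebra_simps)
  show "monoid (quat_alg a b)"
    by (rule monoidI) (auto simp: quat_alg_simps algebra_simps)
qed (auto simp: quat_alg_simps algebra_simps)

locale division_ring = ring R for R (structure) +
  assumes one_not_zero: "\<one> \<noteq> \<zero>"
    and division_ring_Units: "Units R = carrier R - {\<zero>}"

lemma division_ring_quat_alg:
  assumes "a < 0" "b < 0"
  shows "division_ring (quat_alg a b)"
proof -
  interpret ring "quat_alg a b" by (rule ring_quat_alg)
  show ?thesis
  proof
    show nz: "\<one>\<^bsub>quat_alg a b\<^esub> \<noteq> \<zero>\<^bsub>quat_alg a b\<^esub>"
      by (simp add: quat_alg_simps)
    show "Units (quat_alg a b) = carrier (quat_alg a b) - {\<zero>\<^bsub>quat_alg a b\<^esub>}"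
    proof (intro equalityI subsetI)
      fix x assume x: "x \<in> Units (quat_alg a b)"
      have "x \<noteq> \<zero>\<^bsub>quat_alg a b\<^esub>"
        using x nz by (auto simp: Units_def)
      with x show "x \<in> carrier (quat_alg a b) - {\<zero>\<^bsub>quat_alg a b\<^esub>}" by auto
    next
      fix x assume x: "x \<in> carrier (quat_alg a b) - {\<zero>\<^bsub>quat_alg a b\<^esub>}"
      obtain x0 x1 x2 x3 where xq: "x = Quat x0 x1 x2 x3" by (cases x)
      define A B :: rat where "A = - of_int a" and "B = - of_int b"
      have AB: "A > 0" "B > 0" and ab: "of_int a = - A" "of_int b = - B"
        using assms by (auto simp: A_def B_def)
      define N where "N = x0*x0 + A * (x1*x1) + B * (x2*x2) + A * B * (x3*x3)"
      have nn: "0 \<le> x0*x0" "0 \<le> A * (x1*x1)" "0 \<le> B * (x2*x2)" "0 \<le> A * B * (x3*x3)"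
        using AB by auto
      have "N \<noteq> 0"
      proof
        assume "N = 0"
        then have "x0*x0 = 0 \<and> A * (x1*x1) = 0 \<and> B * (x2*x2) = 0 \<and> A * B * (x3*x3) = 0"
          unfolding N_def using nn by linarith
        then show False using x AB by (auto simp: xq quat_alg_simps)
      qed
      define y where "y = Quat (x0/N) (-x1/N) (-x2/N) (-x3/N)"
      have N: "N / N = 1" using \<open>N \<noteq> 0\<close> by simp
      have "x0*x0/N + A * (x1*x1/N) + B * (x2*x2/N) + A * B * (x3*x3/N) = N / N"
        unfolding N_def[symmetric] by (simp add: add_divide_distrib[symmetric] N_def)
      then have "x0*x0/N + A * (x1*x1/N) + B * (x2*x2/N) + A * B * (x3*x3/N) = 1"
        by (simp only: N)
      then have "x \<otimes>\<^bsub>quat_alg a b\<^esub> y = \<one>\<^bsub>quat_alg a b\<^esub>"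
        "y \<otimes>\<^bsub>quat_alg a b\<^esub> x = \<one>\<^bsub>quat_alg a b\<^esub>"
        by (simp_all add: quat_alg_simps xq y_def ab algebra_simps)
      then show "x \<in> Units (quat_alg a b)"
        by (auto simp: Units_def quat_alg_def)
    qed
  qed
qed

definition lipschitz :: "quat set" where
  "lipschitz = {Quat (of_int \<alpha>) (of_int \<beta>) (of_int \<gamma>) (of_int \<delta>) | \<alpha> \<beta> \<gamma> \<delta>. True}"

definition lipschitz_Z :: "quat set" where
  "lipschitz_Z = {Quat (of_int \<alpha>) 0 0 0 | \<alpha>. True}"

definition lipschitz_Zi :: "quat set" where
  "lipschitz_Zi = {Quat (of_int \<alpha>) (of_int \<beta>) 0 0 | \<alpha> \<beta>. True}"

definition lipschitz_Zj :: "quat set" where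
  "lipschitz_Zj = {Quat (of_int \<alpha>) 0 (of_int \<gamma>) 0 | \<alpha> \<gamma>. True}"

lemma lipschitz_altdef: "lipschitz = {q. {qRe q, qI q, qJ q, qK q} \<subseteq> \<int>}"
proof (intro equalityI subsetI)
  fix q assume "q \<in> {q. {qRe q, qI q, qJ q, qK q} \<subseteq> \<int>}"
  then obtain \<alpha> \<beta> \<gamma> \<delta> where "qRe q = of_int \<alpha>" "qI q = of_int \<beta>" "qJ q = of_int \<gamma>" "qK q = of_int \<delta>"
    by (auto elim!: Ints_cases)
  then have "q = Quat (of_int \<alpha>) (of_int \<beta>) (of_int \<gamma>) (of_int \<delta>)"
    by (cases q) simp
  then show "q \<in> lipschitz" by (auto simp: lipschitz_def)
qed (auto simp: lipschitz_def)

lemma subring_lipschitz: "subring lipschitz (quat_alg a b)"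
proof -
  interpret ring "quat_alg a b" by (rule ring_quat_alg)
  show ?thesis
  proof (rule subringI)
    fix h assume h: "h \<in> lipschitz"
    have "\<ominus>\<^bsub>quat_alg a b\<^esub> h = Quat (- qRe h) (- qI h) (- qJ h) (- qK h)"
      by (rule minus_equality) (auto simp: quat_alg_simps)
    then show "\<ominus>\<^bsub>quat_alg a b\<^esub> h \<in> lipschitz"
      using h by (simp add: lipschitz_altdef)
  qed (auto simp: quat_alg_simps lipschitz_altdef)
qed


section \<open>Non-commutative friezes\<close>

text \<open>The vertices of the \<open>m\<close>-gon are \<open>0, \<dots>, m - 1\<close>; only the values \<open>c r s\<close> with
  \<open>r, s < m\<close> and \<open>r \<noteq> s\<close> matter.\<close>

locale nc_frieze = division_ring D for D (structure) +
  fixes m :: nat and c :: "nat \<Rightarrow> nat \<Rightarrow> 'a"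
  assumes three_le: "3 \<le> m"
    and nonzero_entries:
      "\<And>r s. \<lbrakk>r < m; s < m; r \<noteq> s\<rbrakk> \<Longrightarrow> c r s \<in> carrier D - {\<zero>}"
    and triangle:
      "\<And>r r1 r2. \<lbrakk>r < m; r1 = (r + 1) mod m; r2 = (r + 2) mod m\<rbrakk> \<Longrightarrow>
         c r1 r2 \<otimes> inv (c r r2) \<otimes> c r r1 = c r1 r \<otimes> inv (c r2 r) \<otimes> c r2 r1"
    and exchange:
      "\<And>r s r1 s1. \<lbrakk>r < m; s < m; r1 = (r + 1) mod m; s1 = (s + 1) mod m; distinct [r, r1, s, s1]\<rbrakk> \<Longrightarrow>
         c s r = c s s1 \<otimes> inv (c r1 s1) \<otimes> c r1 r \<oplus> c s r1 \<otimes> inv (c s1 r1) \<otimes> c s1 r \<and>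
         c r s = c r r1 \<otimes> inv (c s1 r1) \<otimes> c s1 s \<oplus> c r s1 \<otimes> inv (c r1 s1) \<otimes> c r1 s \<and>
         c r1 s1 = c r1 r \<otimes> inv (c s r) \<otimes> c s s1 \<oplus> c r1 s \<otimes> inv (c r s) \<otimes> c r s1 \<and>
         c s1 r1 = c s1 s \<otimes> inv (c r s) \<otimes> c r r1 \<oplus> c s1 r \<otimes> inv (c s r) \<otimes> c s r1"

definition frieze_entries :: "nat \<Rightarrow> (nat \<Rightarrow> nat \<Rightarrow> 'a) \<Rightarrow> 'a set" where
  "frieze_entries m c = {c r s | r s. r < m \<and> s < m \<and> r \<noteq> s}"

definition boundary_entries :: "nat \<Rightarrow> (nat \<Rightarrow> nat \<Rightarrow> 'a) \<Rightarrow> 'a set" where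
  "boundary_entries m c =
     {c r ((r + 1) mod m) | r. r < m} \<union> {c ((r + 1) mod m) r | r. r < m}"

definition lipschitz_frieze :: "int \<Rightarrow> int \<Rightarrow> nat \<Rightarrow> (nat \<Rightarrow> nat \<Rightarrow> quat) \<Rightarrow> bool" where
  "lipschitz_frieze a b m c \<longleftrightarrow>
     nc_frieze (quat_alg a b) m c \<and>
     frieze_entries m c \<subseteq> lipschitz - {\<zero>\<^bsub>quat_alg a b\<^esub>} \<and>
     boundary_entries m c \<subseteq> {\<one>\<^bsub>quat_alg a b\<^esub>}"

definition frieze_subring :: "int \<Rightarrow> int \<Rightarrow> quat set" where
  "frieze_subring a b =
     generate_ring ((quat_alg a b)\<lparr>carrier := lipschitz\<rparr>)
       (\<Union> {frieze_entries m c | m c. lipschitz_frieze a b m c})"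

end

theory Submission
  imports Defs
begin

text \<open>
  The entries of a frieze with unit boundary are governed by its short diagonals
  \<open>q\<^sub>s = c\<^bsub>s-1,s+1\<^esub>\<close>: along each row they satisfy the recursion
  \<open>c\<^bsub>r,s+1\<^esub> = c\<^bsub>r,s\<^esub> q\<^sub>s - c\<^bsub>r,s-1\<^esub>\<close> (\<open>strip_recursion\<close>). The recursion runs once around the
  polygon, starting with \<open>0, 1\<close> and ending with \<open>1, 0\<close>. Deriving it from the local exchange
  relations requires the triangle relation for every triangle that contains a boundary edge
  (\<open>entry_triangle\<close>).

  For the upper bounds let \<open>S\<close> be \<open>\<int>\<close>, \<open>\<int>[i]\<close> or \<open>\<int>[j]\<close>, as the case may be. It is a commutative
  subring, and a Lipschitz quaternion outside \<open>S\<close> has a component orthogonal to \<open>S\<close> of norm at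
  least 4, because each remaining basis vector has norm at least 4. Hence such a quaternion has
  absolute value at least 2 even after the addition of any element of the fraction field of \<open>S\<close>.
  Suppose that some \<open>q\<^sub>s\<close> is not in \<open>S\<close>; call such vertices \<open>s\<close> bad, and follow the row
  \<open>x\<^sub>u = c\<^bsub>r,u\<^esub>\<close> that starts just before a bad vertex. Between consecutive bad vertices the
  recursion has coefficients in \<open>S\<close>. So if \<open>t, t', t''\<close> are consecutive bad vertices, the entries
  \<open>d = c\<^bsub>t,t'\<^esub>\<close> and \<open>d' = c\<^bsub>t',t''\<^esub>\<close> lie in \<open>S\<close>, and eliminating the good vertices leaves a relation
  \<open>x\<^bsub>t''\<^esub> d'\<^sup>-\<^sup>1 = x\<^bsub>t'\<^esub> (q + \<kappa>) - x\<^bsub>t\<^esub> d\<^sup>-\<^sup>1\<close> with \<open>q\<close> the short diagonal at \<open>t'\<close> and \<open>\<kappa>\<close> in the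
  fraction field of \<open>S\<close>. As \<open>q + \<kappa>\<close> has absolute value at least 2, and \<open>d\<close> and \<open>d'\<close> at least 1, the
  entries at the bad vertices cannot decrease in absolute value, and the same estimate for
  \<open>t'' = r + m\<close> contradicts the fact that the row ends in \<open>0\<close> (\<open>quiddity_in_subring\<close>). So all \<open>q\<^sub>s\<close>
  lie in \<open>S\<close>, and by the recursion all entries do.

  For the lower bounds, a square whose diagonals \<open>x, y\<close> satisfy \<open>x y = 2\<close>, and a hexagon whose
  short diagonals are alternately \<open>x\<close> and \<open>y\<close> with \<open>x y = 3\<close>, are friezes
  (\<open>square_frieze\<close>, \<open>hexagon_frieze\<close>). The factorizations \<open>2 = (1 + i)(1 - i)\<close> for \<open>a = -1\<close>,
  \<open>2 = i (- i)\<close> for \<open>a = -2\<close> and \<open>3 = i (- i)\<close> for \<open>a = -3\<close> put \<open>i\<close> into the frieze subring, and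
  likewise for \<open>j\<close>.
\<close>

section \<open>Exchange relations in a division ring\<close>

context division_ring
begin

lemma inv_nonzero [simp]:
  assumes "x \<in> carrier R - {\<zero>}"
  shows "inv x \<in> carrier R" "x \<otimes> inv x = \<one>" "inv x \<otimes> x = \<one>"
  using assms division_ring_Units by (auto)

lemma left_cancel:
  assumes "x \<in> carrier R - {\<zero>}" "y \<in> carrier R" "z \<in> carrier R" "x \<otimes> y = x \<otimes> z"
  shows "y = z"
  using assms division_ring_Units Units_l_cancel by auto

lemma inv_mult_cancel [simp]:
  assumes "x \<in> carrier R - {\<zero>}" "y \<in> carrier R"
  shows "inv x \<otimes> (x \<otimes> y) = y" "x \<otimes> (inv x \<otimes> y) = y"
  using assms inv_nonzero[of x] by (simp_all add: m_assoc[symmetric] del: inv_nonzero)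

text \<open>
  The hypotheses are exchange relations for the quadrilateral \<open>r, r+1, s, s+1\<close> with
  \<open>p = c\<^bsub>r,s\<^esub>\<close>, \<open>u = c\<^bsub>r+1,s\<^esub>\<close>, \<open>v = c\<^bsub>r,s+1\<^esub>\<close>, \<open>x = c\<^bsub>r+1,s+1\<^esub>\<close>, a prime denoting the opposite
  orientation, and the triangle relations for \<open>(r, r+1, s)\<close> and \<open>(r+1, s, s+1)\<close>. Computing
  \<open>x p'\<close> from the expression for \<open>p'\<close> and from the expression for \<open>x\<close> gives the triangle
  relation for \<open>(r, s, s+1)\<close>; that in turn matches the two expansions of the relation for
  \<open>(r, r+1, s+1)\<close> term by term.
\<close>
lemma triangle_step:
  assumes nz: "p \<in> carrier R - {\<zero>}" "p' \<in> carrier R - {\<zero>}" "u \<in> carrier R - {\<zero>}" "u' \<in> carrier R - {\<zero>}"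
      "v \<in> carrier R - {\<zero>}" "v' \<in> carrier R - {\<zero>}" "x \<in> carrier R - {\<zero>}" "x' \<in> carrier R - {\<zero>}"
    and E1: "p' = inv x \<oplus> u' \<otimes> inv x' \<otimes> v'"
    and E3: "x = inv p' \<oplus> u \<otimes> inv p \<otimes> v"
    and E4: "x' = inv p \<oplus> v' \<otimes> inv p' \<otimes> u'"
    and h1: "p' \<otimes> u = u' \<otimes> p" and h2: "u \<otimes> x' = x \<otimes> u'"
  shows "p \<otimes> v' = v \<otimes> p'" and "v' \<otimes> x = x' \<otimes> v"
proof -
  have car: "p \<in> carrier R" "p' \<in> carrier R" "u \<in> carrier R" "u' \<in> carrier R"
      "v \<in> carrier R" "v' \<in> carrier R" "x \<in> carrier R" "x' \<in> carrier R"
    using nz by auto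
  have "x \<otimes> p' = \<one> \<oplus> (x \<otimes> u') \<otimes> inv x' \<otimes> v'"
    using nz car by (subst E1) (simp add: r_distr m_assoc)
  also have "\<dots> = \<one> \<oplus> u \<otimes> v'"
    unfolding h2[symmetric] using nz car by (simp add: m_assoc)
  finally have 1: "x \<otimes> p' = \<one> \<oplus> u \<otimes> v'" .
  have "x \<otimes> p' = \<one> \<oplus> u \<otimes> (inv p \<otimes> v \<otimes> p')"
    using nz car by (subst E3) (simp add: l_distr m_assoc)
  with 1 have "u \<otimes> v' = u \<otimes> (inv p \<otimes> v \<otimes> p')"
    using nz car by simp
  then have "v' = inv p \<otimes> v \<otimes> p'"
    using nz car by - (rule left_cancel[of u], auto)
  then show A: "p \<otimes> v' = v \<otimes> p'"
    using nz car by (simp add: m_assoc)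
  have B: "inv p \<otimes> v = v' \<otimes> inv p'"
  proof -
    have "inv p \<otimes> v = inv p \<otimes> (v \<otimes> p') \<otimes> inv p'"
      using nz car by (simp add: m_assoc)
    also have "\<dots> = v' \<otimes> inv p'"
      unfolding A[symmetric] using nz car by (simp add: m_assoc)
    finally show ?thesis .
  qed
  have D: "inv p' \<otimes> u' = u \<otimes> inv p"
  proof -
    have "inv p' \<otimes> u' = inv p' \<otimes> (u' \<otimes> p) \<otimes> inv p"
      using nz car by (simp add: m_assoc)
    also have "\<dots> = u \<otimes> inv p"
      unfolding h1[symmetric] using nz car by (simp add: m_assoc)
    finally show ?thesis .
  qed
  have "v' \<otimes> x = v' \<otimes> inv p' \<oplus> v' \<otimes> (u \<otimes> inv p) \<otimes> v"
    using nz car by (subst E3) (simp add: r_distr m_assoc)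
  also have "\<dots> = inv p \<otimes> v \<oplus> v' \<otimes> (inv p' \<otimes> u') \<otimes> v"
    by (simp only: B D)
  also have "\<dots> = x' \<otimes> v"
    using nz car by (subst E4) (simp add: l_distr m_assoc)
  finally show "v' \<otimes> x = x' \<otimes> v" .
qed

text \<open>
  In the notation of \<open>triangle_step\<close>, with \<open>g = c\<^bsub>r,s-1\<^esub>\<close> and \<open>h = c\<^bsub>r+1,s-1\<^esub>\<close>: the quotient
  \<open>c\<^bsub>r,s\<^esub>\<^sup>-\<^sup>1 (c\<^bsub>r,s-1\<^esub> + c\<^bsub>r,s+1\<^esub>)\<close> does not change when \<open>r\<close> is replaced by \<open>r+1\<close>. The two correction
  terms \<open>p u\<^sup>-\<^sup>1 p'\<^sup>-\<^sup>1\<close> and \<open>u'\<^sup>-\<^sup>1\<close> agree by the triangle relation.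
\<close>
lemma recursion_step:
  assumes nz: "p \<in> carrier R - {\<zero>}" "p' \<in> carrier R - {\<zero>}" "u \<in> carrier R - {\<zero>}" "u' \<in> carrier R - {\<zero>}"
    and car: "v \<in> carrier R" "x \<in> carrier R" "g \<in> carrier R" "h \<in> carrier R" "q \<in> carrier R"
    and E3: "x = inv p' \<oplus> u \<otimes> inv p \<otimes> v"
    and E2: "g = inv u' \<oplus> p \<otimes> inv u \<otimes> h"
    and h1: "p' \<otimes> u = u' \<otimes> p" and IH: "x \<oplus> h = u \<otimes> q"
  shows "v \<oplus> g = p \<otimes> q"
proof -
  have car': "p \<in> carrier R" "p' \<in> carrier R" "u \<in> carrier R" "u' \<in> carrier R"
    using nz by auto
  have "u' \<otimes> (p \<otimes> inv u \<otimes> inv p') = (p' \<otimes> u) \<otimes> (inv u \<otimes> inv p')"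
    unfolding h1 using nz car' by (simp add: m_assoc)
  also have "\<dots> = \<one>" using nz car' by (simp add: m_assoc)
  also have "\<dots> = u' \<otimes> inv u'" using nz by simp
  finally have K: "p \<otimes> inv u \<otimes> inv p' = inv u'"
    using nz car' by - (rule left_cancel[of u'], auto)
  have "p \<otimes> q = p \<otimes> inv u \<otimes> (u \<otimes> q)"
    using nz car car' by (simp add: m_assoc)
  also have "\<dots> = p \<otimes> inv u \<otimes> inv p' \<oplus> v \<oplus> p \<otimes> inv u \<otimes> h"
    unfolding IH[symmetric] using nz car car'
    by (subst E3) (simp add: r_distr m_assoc)
  also have "\<dots> = v \<oplus> g"
    unfolding K E2 using nz car car' by (simp add: a_ac)
  finally show ?thesis by simp
qed

end

section \<open>Friezes with unit boundary and their recursion\<close>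

text \<open>
  Vertices are unrolled to all natural numbers, read modulo \<open>m\<close>, so that ranges of vertices
  need no case distinction at vertex \<open>0\<close>.
\<close>
locale unit_frieze = nc_frieze +
  assumes boundary: "boundary_entries m c \<subseteq> {\<one>}"
begin

definition entry :: "nat \<Rightarrow> nat \<Rightarrow> 'a" where
  "entry r s = c (r mod m) (s mod m)"

lemma entry_periodic:
  "entry (r + m) s = entry r s" "entry r (s + m) = entry r s"
  "entry (Suc (r + m)) s = entry (Suc r) s" "entry r (Suc (s + m)) = entry r (Suc s)"
  by (simp_all add: entry_def flip: add_Suc)

lemma mod_distinct:
  assumes "r < s" "s < r + m" shows "r mod m \<noteq> s mod m"
proof
  assume "r mod m = s mod m"
  then have "m dvd s - r" using assms mod_eq_dvd_iff_nat[of r s m] by simp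
  then have "m \<le> s - r" using assms by (intro dvd_imp_le) auto
  then show False using assms by simp
qed

lemma entry_nonzero:
  assumes "r < s" "s < r + m"
  shows "entry r s \<in> carrier D - {\<zero>}" "entry s r \<in> carrier D - {\<zero>}"
  using nonzero_entries[of "r mod m" "s mod m"] nonzero_entries[of "s mod m" "r mod m"]
    mod_distinct[OF assms] three_le by (auto simp: entry_def)

lemma entry_boundary: "entry r (Suc r) = \<one>" "entry (Suc r) r = \<one>"
proof -
  have "r mod m < m" using three_le by simp
  then have "c (r mod m) ((r mod m + 1) mod m) \<in> boundary_entries m c"
    "c ((r mod m + 1) mod m) (r mod m) \<in> boundary_entries m c"
    unfolding boundary_entries_def by blast+
  then have "entry r (r + 1) \<in> boundary_entries m c" "entry (r + 1) r \<in> boundary_entries m c"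
    unfolding entry_def by (simp_all add: mod_Suc_eq)
  then show "entry r (Suc r) = \<one>" "entry (Suc r) r = \<one>"
    using boundary by auto
qed

lemma entry_boundary_wrap: "Suc s = r + m \<Longrightarrow> entry r s = \<one>" "Suc s = r + m \<Longrightarrow> entry s r = \<one>"
  using entry_boundary[of s] entry_periodic by metis+

text \<open>
  Triangles made of two boundary edges are where the relation between both orientations
  starts: with unit boundary their triangle relation says that the inverses agree.
\<close>
lemma entry_skip_symmetric: "entry (s + 2) s = entry s (s + 2)"
proof -
  have nz: "entry s (s + 2) \<in> carrier D - {\<zero>}" "entry (s + 2) s \<in> carrier D - {\<zero>}"
    using entry_nonzero[of s "s + 2"] three_le by auto
  have *: "Suc (s mod m) mod m = Suc s mod m" "Suc (Suc (s mod m)) mod m = Suc (Suc s) mod m"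
    by (metis mod_Suc_eq)+
  have "entry (Suc s) (s + 2) \<otimes> inv entry s (s + 2) \<otimes> entry s (Suc s) =
        entry (Suc s) s \<otimes> inv entry (s + 2) s \<otimes> entry (s + 2) (Suc s)"
    using triangle[of "s mod m" "Suc s mod m" "(s + 2) mod m"] three_le
    unfolding entry_def by (simp add: * )
  then have "inv entry s (s + 2) = inv entry (s + 2) s"
    using entry_boundary[of s] entry_boundary[of "Suc s"] nz by simp
  then have "entry s (s + 2) \<otimes> inv entry (s + 2) s = \<one>"
    using nz by (metis inv_nonzero(2))
  then have "entry s (s + 2) \<otimes> inv entry (s + 2) s \<otimes> entry (s + 2) s = entry (s + 2) s"
    using nz by simp
  then show ?thesis using nz by (simp add: m_assoc)
qed

lemma entry_exchange:
  assumes "r + 2 \<le> s" "s + 2 \<le> r + m"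
  shows "entry s r = inv entry (Suc r) (Suc s) \<oplus> entry s (Suc r) \<otimes> inv entry (Suc s) (Suc r) \<otimes> entry (Suc s) r"
    and "entry r s = inv entry (Suc s) (Suc r) \<oplus> entry r (Suc s) \<otimes> inv entry (Suc r) (Suc s) \<otimes> entry (Suc r) s"
    and "entry (Suc r) (Suc s) = inv entry s r \<oplus> entry (Suc r) s \<otimes> inv entry r s \<otimes> entry r (Suc s)"
    and "entry (Suc s) (Suc r) = inv entry r s \<oplus> entry (Suc s) r \<otimes> inv entry s r \<otimes> entry s (Suc r)"
proof -
  have nz: "entry r s \<in> carrier D - {\<zero>}" "entry s r \<in> carrier D - {\<zero>}"
    "entry (Suc r) (Suc s) \<in> carrier D - {\<zero>}" "entry (Suc s) (Suc r) \<in> carrier D - {\<zero>}"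
    using entry_nonzero[of r s] entry_nonzero[of "Suc r" "Suc s"] assms by auto
  have *: "Suc r mod m = (r mod m + 1) mod m" "Suc s mod m = (s mod m + 1) mod m"
    by (simp_all add: mod_Suc_eq)
  have one: "\<one> \<otimes> inv x \<otimes> \<one> = inv x" if "x \<in> carrier D - {\<zero>}" for x
    using that by simp
  have d: "distinct [r mod m, Suc r mod m, s mod m, Suc s mod m]"
    using mod_distinct[of r "Suc r"] mod_distinct[of r s] mod_distinct[of r "Suc s"]
      mod_distinct[of "Suc r" s] mod_distinct[of "Suc r" "Suc s"] mod_distinct[of s "Suc s"] assms
    by auto
  have rs: "r mod m < m" "s mod m < m" using three_le by simp_all
  note ex = exchange[OF rs * d, folded entry_def, unfolded entry_boundary nz[THEN one]]
  show "entry s r = inv entry (Suc r) (Suc s) \<oplus> entry s (Suc r) \<otimes> inv entry (Suc s) (Suc r) \<otimes> entry (Suc s) r"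
    and "entry r s = inv entry (Suc s) (Suc r) \<oplus> entry r (Suc s) \<otimes> inv entry (Suc r) (Suc s) \<otimes> entry (Suc r) s"
    and "entry (Suc r) (Suc s) = inv entry s r \<oplus> entry (Suc r) s \<otimes> inv entry r s \<otimes> entry r (Suc s)"
    and "entry (Suc s) (Suc r) = inv entry r s \<oplus> entry (Suc s) r \<otimes> inv entry s r \<otimes> entry s (Suc r)"
    using ex by blast+
qed

text \<open>
  One exchange relation at distance \<open>k\<close> needs the triangle relation at distances \<open>k\<close> and
  \<open>m + 1 - k\<close> and yields it at \<open>k + 1\<close> and \<open>m - k\<close>. So the induction advances from both ends at
  once, starting with the triangles at distances \<open>2\<close> and \<open>m - 1\<close>, which have two boundary edges.
\<close>
lemma entry_triangle_by_distance:
  assumes "2 \<le> k" "k < m"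
  shows "\<forall>r. entry (r + k) r \<otimes> entry (Suc r) (r + k) = entry (r + k) (Suc r) \<otimes> entry r (r + k) \<and>
             entry (r + m + 1 - k) r \<otimes> entry (Suc r) (r + m + 1 - k) =
             entry (r + m + 1 - k) (Suc r) \<otimes> entry r (r + m + 1 - k)"
  using assms
proof (induction k rule: dec_induct)
  case base
  show ?case
  proof (intro allI conjI)
    fix r
    have car: "entry (r + 2) r \<in> carrier D" "entry r (r + 2) \<in> carrier D" "entry (Suc r) (r+m+1-2) \<in> carrier D"
      using entry_nonzero[of r "r+2"] entry_nonzero[of "Suc r" "r + m + 1 -2"] three_le by auto
    show "entry (r + 2) r \<otimes> entry (Suc r) (r + 2) = entry (r + 2) (Suc r) \<otimes> entry r (r + 2)"
      using entry_boundary[of "Suc r"] entry_skip_symmetric[of r] car by simp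
    have "entry (r + m + 1 - 2) r = \<one>" "entry r (r + m + 1 - 2) = \<one>"
      using three_le by (auto intro: entry_boundary_wrap)
    moreover have "entry (Suc r) (r + m + 1 - 2) = entry (r + m + 1 - 2) (Suc r)"
      using entry_skip_symmetric[of "r + m + 1 - 2"] three_le entry_periodic[of "Suc r"] entry_periodic[of _ "Suc r"]
      by simp
    ultimately show "entry (r + m + 1 - 2) r \<otimes> entry (Suc r) (r + m + 1 - 2) =
             entry (r + m + 1 - 2) (Suc r) \<otimes> entry r (r + m + 1 - 2)"
      using car by simp
  qed
next
  case (step k)
  then have k: "2 \<le> k" "k + 2 \<le> m + 1" by auto
  have km: "k + 2 \<le> m" using step by auto
  note IH = step.IH[THEN spec]
  have *: "entry r (r + k) \<otimes> entry (Suc (r + k)) r = entry r (Suc (r + k)) \<otimes> entry (r + k) r \<and>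
        entry (Suc (r + k)) r \<otimes> entry (Suc r) (Suc (r + k)) = entry (Suc (r + k)) (Suc r) \<otimes> entry r (Suc (r + k))"
    (is "?A \<and> ?B") for r
  proof -
    let ?s = "r + k"
    have h1: "entry ?s r \<otimes> entry (Suc r) ?s = entry ?s (Suc r) \<otimes> entry r ?s"
      using IH[of r] step.prems by auto
    \<comment> \<open>\<open>r + 1\<close> is the vertex \<open>m + 1 - k\<close> steps after \<open>r + k\<close>\<close>
    have "?s + m + 1 - k = Suc r + m" using km by simp
    then have h2: "entry (Suc r) ?s \<otimes> entry (Suc ?s) (Suc r) = entry (Suc r) (Suc ?s) \<otimes> entry ?s (Suc r)"
      using IH[of ?s] step.prems by (simp add: entry_periodic)
    have r: "r + 2 \<le> ?s" "?s + 2 \<le> r + m" using km k by auto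
    show ?thesis
      using triangle_step[OF _ _ _ _ _ _ _ _ entry_exchange(1)[OF r] entry_exchange(3)[OF r] entry_exchange(4)[OF r] h1 h2]
        entry_nonzero[of r ?s] entry_nonzero[of "Suc r" ?s] entry_nonzero[of r "Suc ?s"] entry_nonzero[of "Suc r" "Suc ?s"] r
      by auto
  qed
  show ?case
  proof (intro allI conjI)
    fix r
    show "entry (r + Suc k) r \<otimes> entry (Suc r) (r + Suc k) = entry (r + Suc k) (Suc r) \<otimes> entry r (r + Suc k)"
      using *[of r] by simp
    have "r + m + 1 - Suc k = r + m - k" "r + m - k + k = r + m"
      "\<And>s. entry s (Suc (r + m)) = entry s (Suc r)" using km entry_periodic by auto
    with *[of "r + m - k"] show "entry (r + m + 1 - Suc k) r \<otimes> entry (Suc r) (r + m + 1 - Suc k) =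
             entry (r + m + 1 - Suc k) (Suc r) \<otimes> entry r (r + m + 1 - Suc k)"
      by (simp only: entry_periodic)
  qed
qed

lemma entry_triangle:
  assumes "r + 2 \<le> s" "s < r + m"
  shows "entry s r \<otimes> entry (Suc r) s = entry s (Suc r) \<otimes> entry r s"
proof -
  obtain k where k: "s = r + k" using assms by (auto simp: le_iff_add)
  have "2 \<le> k" "k < m" using assms k by auto
  then show ?thesis using entry_triangle_by_distance unfolding k by blast
qed

lemma entry_recursion:
  assumes "2 \<le> k" "k + 2 \<le> m"
  shows "\<forall>r. entry r (Suc (r + k)) \<oplus> entry r (r + k - 1) = entry r (r + k) \<otimes> entry (r + k - 1) (Suc (r + k))"
  using assms
proof (induction k rule: dec_induct)
  case base
  show ?case
  proof
    fix r
    have nz: "entry r (r+2) \<in> carrier D - {\<zero>}" "entry r (Suc (r+2)) \<in> carrier D - {\<zero>}"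
      using entry_nonzero[of r "r+2"] entry_nonzero[of r "Suc (r+2)"] base by auto
    have eq: "entry (Suc r) (Suc (r+2)) = inv entry r (r+2) \<oplus> inv entry r (r+2) \<otimes> entry r (Suc (r+2))"
      using entry_exchange(3)[of r "r+2"] base entry_boundary[of "Suc r"] entry_skip_symmetric[of r] nz by simp
    have "entry r (r+2) \<otimes> entry (Suc r) (Suc (r+2)) = \<one> \<oplus> entry r (Suc (r+2))"
      unfolding eq using nz by (simp add: r_distr)
    then show "entry r (Suc (r + 2)) \<oplus> entry r (r + 2 - 1) = entry r (r + 2) \<otimes> entry (r + 2 - 1) (Suc (r + 2))"
      using entry_boundary[of r] nz by (simp add: a_comm)
  qed
next
  case (step k)
  show ?case
  proof
    fix r
    let ?s = "r + Suc k"
    have r1: "r + 2 \<le> ?s" "?s + 2 \<le> r + m" using step by auto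
    have r2: "r + 2 \<le> r + k" "r + k + 2 \<le> r + m" using step by auto
    have IH: "entry (Suc r) (Suc ?s) \<oplus> entry (Suc r) (r + k) = entry (Suc r) ?s \<otimes> entry (r + k) (Suc ?s)"
      using step.IH step.prems by (auto dest: spec[of _ "Suc r"])
    have "entry r (Suc ?s) \<oplus> entry r (r + k) = entry r ?s \<otimes> entry (r + k) (Suc ?s)"
      using recursion_step[OF _ _ _ _ _ _ _ _ _ entry_exchange(3)[OF r1] _ entry_triangle[of r ?s] IH, of "entry r (r + k)"]
        entry_exchange(2)[OF r2] r1 r2 step.hyps
        entry_nonzero[of r ?s] entry_nonzero[of "Suc r" ?s] entry_nonzero[of r "Suc ?s"] entry_nonzero[of "Suc r" "Suc ?s"]
        entry_nonzero[of r "r + k"] entry_nonzero[of "Suc r" "r + k"] entry_nonzero[of "r + k" "Suc ?s"]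
      by auto
    then show "entry r (Suc (r + Suc k)) \<oplus> entry r (r + Suc k - 1) = entry r (r + Suc k) \<otimes> entry (r + Suc k - 1) (Suc (r + Suc k))"
      by simp
  qed
qed

text \<open>
  The conventional zeros of a frieze pattern, on both borders of the strip \<open>r \<le> s \<le> r + m\<close>, make the
  recursion valid along a whole row. At these places \<open>entry r s\<close> would be a value of \<open>c\<close> on a
  pair of equal vertices.
\<close>
definition strip :: "nat \<Rightarrow> nat \<Rightarrow> 'a" where
  "strip r s = (if s = r \<or> s = r + m then \<zero> else entry r s)"

lemma strip_recursion:
  assumes "r \<le> s" "s + 2 \<le> r + m"
  shows "strip r (s + 2) \<oplus> strip r s = strip r (s + 1) \<otimes> strip s (s + 2)"
proof -
  have Cs: "strip s (s + 2) = entry s (s + 2)" using three_le by (simp add: strip_def)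
  have car: "entry s (s + 2) \<in> carrier D - {\<zero>}" "entry (s + 2) s \<in> carrier D - {\<zero>}"
    using entry_nonzero[of s "s+2"] three_le by auto
  consider "s = r" | "s + 2 = r + m" "s \<noteq> r" | "r + 1 \<le> s" "s + 3 \<le> r + m"
    using assms by linarith
  then show ?thesis
  proof cases
    case 1
    then show ?thesis using Cs car entry_boundary[of s] three_le by (simp add: strip_def)
  next
    case 2
    have "strip r (s + 1) = \<one>" using 2 three_le entry_boundary_wrap[of "s+1" r] by (auto simp: strip_def)
    moreover have "strip r (s + 2) = \<zero>" using 2 by (simp add: strip_def)
    moreover have "strip r s = entry (s + 2) s" using 2 entry_periodic by (simp add: strip_def)
    ultimately show ?thesis using Cs car entry_skip_symmetric[of s] by simp
  next
    case 3
    define k where "k = s + 1 - r"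
    have k: "s = r + k - 1" "2 \<le> k" "k + 2 \<le> m" using 3 by (auto simp: k_def)
    show ?thesis using entry_recursion[OF k(2,3), THEN spec, of r] 3 three_le k
      by (auto simp: strip_def)
  qed
qed

end

section \<open>Recursions that close up with nonzero entries\<close>

text \<open>
  What the growth argument uses of a frieze: rows \<open>0, 1, \<dots>, 0\<close> of length \<open>m\<close>, nonzero inside,
  that satisfy the recursion with the short diagonals \<open>C s (s + 2)\<close> as coefficients.
\<close>
locale frieze_recursion = ring R for R (structure) +
  fixes m :: nat and C :: "nat \<Rightarrow> nat \<Rightarrow> 'a"
  assumes C_closed: "\<lbrakk>r \<le> s; s \<le> r + m\<rbrakk> \<Longrightarrow> C r s \<in> carrier R"
    and C_diagonal: "C r r = \<zero>"
    and C_next: "C r (Suc r) = \<one>"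
    and C_wrap: "C r (r + m) = \<zero>"
    and C_nonzero: "\<lbrakk>r < s; s < r + m\<rbrakk> \<Longrightarrow> C r s \<noteq> \<zero>"
    and C_recursion: "\<lbrakk>r \<le> s; s + 2 \<le> r + m\<rbrakk> \<Longrightarrow>
      C r (s + 2) \<oplus> C r s = C r (s + 1) \<otimes> C s (s + 2)"
begin

lemma C_forward:
  assumes "r \<le> s" "s + 2 \<le> r + m"
  shows "C r (s + 2) = C r (s + 1) \<otimes> C s (s + 2) \<ominus> C r s"
proof -
  have "C r (s + 2) \<in> carrier R" "C r s \<in> carrier R" using C_closed assms by auto
  then show ?thesis unfolding C_recursion[OF assms, symmetric] by algebra
qed

lemma C_mem_of_quiddity:
  assumes S: "subring S R" and q: "\<And>i. \<lbrakk>r \<le> i; i + 2 \<le> r + m\<rbrakk> \<Longrightarrow> C i (i + 2) \<in> S"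
    and "1 \<le> m" and "r \<le> s" "s \<le> r + m"
  shows "C r s \<in> S"
  using assms(4,5)
proof (induction s rule: less_induct)
  case (less s)
  consider "s = r" | "s = Suc r" | i where "s = i + 2" "r \<le> i"
  proof -
    have "s = (s - 2) + 2 \<and> r \<le> s - 2" if "s \<noteq> r" "s \<noteq> Suc r" using that less.prems by linarith
    then show thesis using that by blast
  qed
  then show ?case
  proof cases
    case 3
    then show ?thesis
      using less C_forward[of r i] q[of i] subringE[OF S] by (simp add: a_minus_def)
  qed (use subringE[OF S] C_diagonal C_next in auto)
qed

text \<open>
  Let \<open>j+1\<close> and \<open>k+1\<close> be vertices with only vertices of short diagonal in \<open>S\<close> strictly between
  them. The row of \<open>j+1\<close> stays in \<open>S\<close> there. Commutativity of \<open>S\<close> makes the two-by-two minor of row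
  \<open>r\<close> against the row of \<open>j+1\<close> constant, which is the first equation; the second one says that
  row \<open>r\<close> is a combination of two consecutive entries with coefficients in \<open>S\<close>.
\<close>
lemma entries_along_run:
  assumes S: "subcring S R"
    and q: "\<And>i. \<lbrakk>j < i; i < k\<rbrakk> \<Longrightarrow> C i (i + 2) \<in> S"
    and "r \<le> j" "j < k" "k + 1 \<le> r + m"
  shows "C (Suc j) k \<in> S" "C (Suc j) (Suc k) \<in> S"
    and "C r (Suc j) = C r k \<otimes> C (Suc j) (Suc k) \<ominus> C r (Suc k) \<otimes> C (Suc j) k"
    and "\<exists>A\<in>S. C r (Suc k) = C r (j + 2) \<otimes> C (Suc j) (Suc k) \<oplus> C r (Suc j) \<otimes> A"
proof -
  note S_simps = subcringE[OF S]
  \<comment> \<open>both rows obey the same recursion along the run\<close>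
  define d where "d = C (Suc j)"
  define x where "x = C r"
  have x: "x u \<in> carrier R" if "r \<le> u" "u \<le> r + m" for u using that by (auto simp: x_def C_closed)
  have xj: "x (Suc j) \<in> carrier R" "x (j + 2) \<in> carrier R" using assms by (auto intro!: x)
  have P: "d u \<in> S \<and> d (Suc u) \<in> S \<and> x (Suc j) = x u \<otimes> d (Suc u) \<ominus> x (Suc u) \<otimes> d u \<and>
           (\<exists>A\<in>S. x u = x (j + 2) \<otimes> d u \<oplus> x (Suc j) \<otimes> A) \<and>
           (\<exists>A\<in>S. x (Suc u) = x (j + 2) \<otimes> d (Suc u) \<oplus> x (Suc j) \<otimes> A)"
    if "Suc j \<le> u" "u \<le> k" for u
    using that
  proof (induction u rule: dec_induct)
    case base
    have "d (Suc j) = \<zero>" "d (Suc (Suc j)) = \<one>" by (simp_all add: d_def C_diagonal C_next)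
    then show ?case using xj S_simps(2,3,5)
      by (intro conjI bexI[of _ "\<one>"] bexI[of _ "\<zero>"]) (auto simp: a_minus_def)
  next
    case (step u)
    define y where "y = C u (u + 2)"
    have y: "y \<in> S" unfolding y_def using q[of u] step by auto
    have d2: "d (Suc (Suc u)) = d (Suc u) \<otimes> y \<ominus> d u"
      unfolding d_def y_def using C_forward[of "Suc j" u] step assms by simp
    have x2: "x (Suc (Suc u)) = x (Suc u) \<otimes> y \<ominus> x u"
      unfolding x_def y_def using C_forward[of r u] step assms by simp
    note ih = step.IH[OF Suc_leD[OF step.prems]]
    have IH: "d u \<in> S" "d (Suc u) \<in> S" "x (Suc j) = x u \<otimes> d (Suc u) \<ominus> x (Suc u) \<otimes> d u"
      using ih by blast+
    obtain A A' where A: "A \<in> S" "x u = x (j + 2) \<otimes> d u \<oplus> x (Suc j) \<otimes> A"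
      and A': "A' \<in> S" "x (Suc u) = x (j + 2) \<otimes> d (Suc u) \<oplus> x (Suc j) \<otimes> A'"
      using ih by blast
    have car: "d u \<in> carrier R" "d (Suc u) \<in> carrier R" "y \<in> carrier R" "A \<in> carrier R" "A' \<in> carrier R"
      "x u \<in> carrier R" "x (Suc u) \<in> carrier R"
      using IH y A A' S_simps(1) xj by auto
    have "x (Suc u) \<otimes> d (Suc (Suc u)) \<ominus> x (Suc (Suc u)) \<otimes> d (Suc u)
        = x (Suc u) \<otimes> (d (Suc u) \<otimes> y) \<ominus> x (Suc u) \<otimes> (y \<otimes> d (Suc u)) \<oplus> x u \<otimes> d (Suc u) \<ominus> x (Suc u) \<otimes> d u"
      unfolding d2 x2 using car by algebra
    also have "\<dots> = x (Suc j)"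
      unfolding S_simps(8)[OF y IH(2)] IH(3) using car by algebra
    finally have "x (Suc j) = x (Suc u) \<otimes> d (Suc (Suc u)) \<ominus> x (Suc (Suc u)) \<otimes> d (Suc u)" ..
    moreover have "d (Suc (Suc u)) \<in> S"
      unfolding d2 a_minus_def using IH y S_simps by auto
    moreover have "x (Suc (Suc u)) = x (j + 2) \<otimes> d (Suc (Suc u)) \<oplus> x (Suc j) \<otimes> (A' \<otimes> y \<ominus> A)"
      unfolding d2 x2 by (subst A'(2), subst A(2)) (use car xj in algebra)
    moreover have "A' \<otimes> y \<ominus> A \<in> S" unfolding a_minus_def using A A' y S_simps by auto
    ultimately show ?case using IH A' by blast
  qed
  from P[of k] show "C (Suc j) k \<in> S" "C (Suc j) (Suc k) \<in> S"
    and "C r (Suc j) = C r k \<otimes> C (Suc j) (Suc k) \<ominus> C r (Suc k) \<otimes> C (Suc j) k"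
    and "\<exists>A\<in>S. C r (Suc k) = C r (j + 2) \<otimes> C (Suc j) (Suc k) \<oplus> C r (Suc j) \<otimes> A"
    using assms by (auto simp: d_def x_def)
qed

end

locale normed_frieze_recursion = frieze_recursion +
  fixes N :: "'a \<Rightarrow> rat"
  assumes N_mult: "\<lbrakk>x \<in> carrier R; y \<in> carrier R\<rbrakk> \<Longrightarrow> N (x \<otimes> y) = N x * N y"
    and N_nonneg: "N x \<ge> 0"
    and N_eq_0_iff: "x \<in> carrier R \<Longrightarrow> N x = 0 \<longleftrightarrow> x = \<zero>"
    and N_minus: "\<lbrakk>x \<in> carrier R; y \<in> carrier R\<rbrakk> \<Longrightarrow> N x \<le> 2 * N (x \<ominus> y) + 2 * N y"
begin

text \<open>
  Here \<open>xt\<close> and \<open>x1\<close> are the entries of a row at consecutive bad vertices, \<open>x0\<close> and \<open>x2\<close> the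
  neighbours of \<open>x1\<close>, and \<open>q\<close> is the short diagonal at the second vertex. The conclusion is a
  denominator-free way of saying that \<open>x1\<^sup>-\<^sup>1 x2\<close> keeps distance at least 1 from the fraction field of
  \<open>S\<close>. Multiplied by \<open>d\<close>, the element on the right becomes \<open>x1 W - xt f\<close>. The norm of \<open>x1 W\<close> is
  at least four times that of \<open>x1 f d\<close>, by the gap, and the norm of \<open>xt f\<close> is at most that of
  \<open>x1 f d\<close>, so the parallelogram inequality bounds the difference below by the norm of \<open>x1 f d\<close>.
\<close>
lemma growth_step:
  assumes car: "x0 \<in> carrier R" "x1 \<in> carrier R" "xt \<in> carrier R" "q \<in> carrier R"
    and S: "subcring S R" and dS: "d \<in> S" "1 \<le> N d" "d0 \<in> S" "f \<in> S" "B \<in> S"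
    and gap: "\<And>D A. \<lbrakk>D \<in> S; A \<in> S\<rbrakk> \<Longrightarrow> 4 * N D \<le> N (q \<otimes> D \<oplus> A)"
    and xt: "xt = x0 \<otimes> d \<ominus> x1 \<otimes> d0" and x2: "x2 = x1 \<otimes> q \<ominus> x0"
    and le: "N xt * N d \<le> N x1"
  shows "N x1 * N f \<le> N (x2 \<otimes> f \<oplus> x1 \<otimes> B)"
proof -
  note S_simps = subcringE[OF S]
  have carS: "d \<in> carrier R" "d0 \<in> carrier R" "f \<in> carrier R" "B \<in> carrier R"
    using dS S_simps(1) by auto
  define W where "W = q \<otimes> (f \<otimes> d) \<oplus> (B \<otimes> d \<ominus> d0 \<otimes> f)"
  have W: "4 * N (f \<otimes> d) \<le> N W" unfolding W_def
    by (rule gap) (use dS S_simps in \<open>auto simp: a_minus_def\<close>)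
  have "(x2 \<otimes> f \<oplus> x1 \<otimes> B) \<otimes> d = x1 \<otimes> q \<otimes> (f \<otimes> d) \<ominus> x0 \<otimes> (f \<otimes> d) \<oplus> x1 \<otimes> B \<otimes> d"
    unfolding x2 using car carS by algebra
  also have "\<dots> = x1 \<otimes> q \<otimes> (f \<otimes> d) \<ominus> x0 \<otimes> (d \<otimes> f) \<oplus> x1 \<otimes> B \<otimes> d"
    using S_simps(8)[OF dS(1,4)] by simp
  also have "\<dots> = x1 \<otimes> W \<ominus> xt \<otimes> f"
    unfolding W_def xt using car carS by algebra
  finally have eq: "(x2 \<otimes> f \<oplus> x1 \<otimes> B) \<otimes> d = x1 \<otimes> W \<ominus> xt \<otimes> f" .
  have Wc: "W \<in> carrier R" unfolding W_def using car carS by auto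
  have x2c: "x2 \<in> carrier R" unfolding x2 using car by auto
  have "N xt \<le> N xt * N d" using mult_left_mono[OF dS(2) N_nonneg[of xt]] by simp
  with le have "N xt \<le> N x1" by simp
  moreover have "N f \<le> N f * N d" using mult_left_mono[OF dS(2) N_nonneg[of f]] by simp
  ultimately have y: "N xt * N f \<le> N x1 * (N f * N d)"
    by (intro mult_mono N_nonneg)
  have "N x1 * (4 * (N f * N d)) \<le> N x1 * N W"
    using W carS by (intro mult_left_mono N_nonneg) (simp add: N_mult)
  also have "\<dots> \<le> 2 * N (x1 \<otimes> W \<ominus> xt \<otimes> f) + 2 * (N xt * N f)"
    using N_minus[of "x1 \<otimes> W" "xt \<otimes> f"] car carS Wc by (simp add: N_mult)
  finally have "N x1 * (N f * N d) \<le> N (x1 \<otimes> W \<ominus> xt \<otimes> f)" using y by simp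
  also have "\<dots> = N (x2 \<otimes> f \<oplus> x1 \<otimes> B) * N d"
    unfolding eq[symmetric] using car carS x2c by (simp add: N_mult)
  finally show ?thesis using dS(2) by simp
qed

text \<open>
  Along the row that starts just before a bad vertex, the entries at the bad vertices do not
  decrease in norm, and the last of them keeps the row from returning to \<open>0\<close>. The row begins before a bad vertex, rather than at one,
  so that it meets a bad vertex even if there is only one.
\<close>
theorem quiddity_in_subring:
  assumes S: "subcring S R" and S_bound: "\<And>d. \<lbrakk>d \<in> S; d \<noteq> \<zero>\<rbrakk> \<Longrightarrow> 1 \<le> N d"
    and L: "\<And>i. C i (i + 2) \<in> L"
    and gap: "\<And>q D A. \<lbrakk>q \<in> L; q \<notin> S; D \<in> S; A \<in> S\<rbrakk> \<Longrightarrow> 4 * N D \<le> N (q \<otimes> D \<oplus> A)"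
    and m: "2 \<le> m"
  shows "C r (r + 2) \<in> S"
proof (rule ccontr)
  assume bad: "C r (r + 2) \<notin> S"
  note S_simps = subcringE[OF S]
  \<comment> \<open>the quotient of the entries at \<open>j + 2\<close> and \<open>j + 1\<close> has distance at least 1 from the fraction field of \<open>S\<close>\<close>
  define dominates where "dominates j \<longleftrightarrow>
    (\<forall>f\<in>S. \<forall>B\<in>S. N (C r (Suc j)) * N f \<le> N (C r (j + 2) \<otimes> f \<oplus> C r (Suc j) \<otimes> B))" for j
  have last_bad: "\<exists>j. r \<le> j \<and> j < k \<and> C j (j + 2) \<notin> S \<and> (\<forall>i. j < i \<and> i < k \<longrightarrow> C i (i + 2) \<in> S)"
    if "r < k" for k
  proof -
    define J where "J = {j. r \<le> j \<and> j < k \<and> C j (j + 2) \<notin> S}"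
    have J: "finite J" "J \<noteq> {}" using that bad by (auto simp: J_def)
    obtain j where j: "j \<in> J" "\<And>i. i \<in> J \<Longrightarrow> i \<le> j"
      using Max_in[OF J] Max_ge[OF J(1)] by blast
    have "C i (i + 2) \<in> S" if "j < i" "i < k" for i
      using j(1) j(2)[of i] that by (auto simp: J_def)
    then show ?thesis using j(1) unfolding J_def by blast
  qed
  have growth: "N (C r (Suc j)) * N (C (Suc j) (Suc k)) \<le> N (C r (Suc k))"
    if "dominates j" "r \<le> j" "j < k" "k + 1 \<le> r + m" "\<And>i. \<lbrakk>j < i; i < k\<rbrakk> \<Longrightarrow> C i (i + 2) \<in> S" for j k
    using entries_along_run(2,4)[OF S that(5) that(2-4)] that(1) unfolding dominates_def by fastforce
  have dominates: "dominates k" if "r \<le> k" "k + 2 \<le> r + m" "C k (k + 2) \<notin> S" for k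
    using that
  proof (induction k rule: less_induct)
    case (less k)
    show ?case
    proof (cases "k = r")
      case True
      have "C r (r + 2) \<in> carrier R" using m by (auto intro: C_closed)
      moreover have "N \<one> = 1"
      proof -
        have "N \<one> * N \<one> = N \<one>" using N_mult[of \<one> \<one>] by simp
        moreover have "\<one> \<noteq> \<zero>" using C_nonzero[of 0 1] C_next[of 0] m by simp
        ultimately show ?thesis using N_eq_0_iff[of \<one>] by simp
      qed
      moreover have "N f \<le> N (C r (r + 2) \<otimes> f \<oplus> B)" if "f \<in> S" "B \<in> S" for f B
        using gap[OF L bad that] N_nonneg[of f] by linarith
      ultimately show ?thesis unfolding dominates_def True C_next using S_simps(1) by auto
    next
      case False
      then have "r < k" using less by simp
      then obtain j where j: "r \<le> j" "j < k" "C j (j + 2) \<notin> S" "\<And>i. \<lbrakk>j < i; i < k\<rbrakk> \<Longrightarrow> C i (i + 2) \<in> S"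
        using last_bad by blast
      have k: "k + 1 \<le> r + m" using less by simp
      have dominates_j: "dominates j" using less j by auto
      note st = entries_along_run[OF S j(4) j(1,2) k]
      have d: "C (Suc j) (Suc k) \<noteq> \<zero>" using C_nonzero[of "Suc j" "Suc k"] j less by auto
      have fw: "C r (k + 2) = C r (Suc k) \<otimes> C k (k + 2) \<ominus> C r k"
        using C_forward[of r k] less by simp
      show ?thesis unfolding dominates_def
      proof (intro ballI)
        fix f B assume fB: "f \<in> S" "B \<in> S"
        show "N (C r (Suc k)) * N f \<le> N (C r (k + 2) \<otimes> f \<oplus> C r (Suc k) \<otimes> B)"
          by (rule growth_step[OF _ _ _ _ S st(2) S_bound[OF st(2) d] st(1) fB gap[OF L less.prems(3)] st(3) fw
                growth[OF dominates_j j(1,2) k j(4)]])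
             (use j less m in \<open>auto intro!: C_closed\<close>)
      qed
    qed
  qed
  \<comment> \<open>the run after the last bad vertex reaches the final zero of the row\<close>
  define k where "k = r + m - 1"
  have k: "r < k" "k + 1 = r + m" "Suc k = r + m" using m by (auto simp: k_def)
  obtain j where j: "r \<le> j" "j < k" "C j (j + 2) \<notin> S" "\<And>i. \<lbrakk>j < i; i < k\<rbrakk> \<Longrightarrow> C i (i + 2) \<in> S"
    using last_bad[OF k(1)] by blast
  have nz: "C r (Suc j) \<noteq> \<zero>" "C (Suc j) (Suc k) \<noteq> \<zero>" using C_nonzero j k by auto
  have "C r (Suc j) \<in> carrier R" "C (Suc j) (Suc k) \<in> carrier R" using C_closed j k by auto
  then have "N (C r (Suc j)) * N (C (Suc j) (Suc k)) \<noteq> 0" using nz N_eq_0_iff by auto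
  moreover have "N (C r (Suc j)) * N (C (Suc j) (Suc k)) \<le> N \<zero>"
    using growth[OF dominates j(1,2) _ j(4)] j k C_wrap[of r] by auto
  moreover have "0 \<le> N (C r (Suc j)) * N (C (Suc j) (Suc k))"
    by (intro mult_nonneg_nonneg N_nonneg)
  ultimately show False using N_eq_0_iff[of \<zero>] by simp
qed

end

section \<open>The norm form and the gap around the small subrings\<close>

text \<open>
  This is \<open>q\<close> times its conjugate, the square of an absolute value.
\<close>
definition qnorm :: "int \<Rightarrow> int \<Rightarrow> quat \<Rightarrow> rat" where
  "qnorm a b q = qRe q * qRe q + of_int (- a) * (qI q * qI q) + of_int (- b) * (qJ q * qJ q)
     + of_int (a * b) * (qK q * qK q)"

lemma quat_a_inv: "\<ominus>\<^bsub>quat_alg a b\<^esub> q = Quat (- qRe q) (- qI q) (- qJ q) (- qK q)"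
proof -
  interpret ring "quat_alg a b" by (rule ring_quat_alg)
  show ?thesis by (rule minus_equality) (auto simp: quat_alg_simps)
qed

lemma quat_a_minus:
  "p \<ominus>\<^bsub>quat_alg a b\<^esub> q = Quat (qRe p - qRe q) (qI p - qI q) (qJ p - qJ q) (qK p - qK q)"
  unfolding a_minus_def quat_a_inv by (simp add: quat_alg_def)

lemma qnorm_mult: "qnorm a b (p \<otimes>\<^bsub>quat_alg a b\<^esub> q) = qnorm a b p * qnorm a b q"
  by (simp add: qnorm_def quat_alg_simps algebra_simps)

lemma qnorm_terms_nonneg:
  assumes "a < 0" "b < 0"
  shows "0 \<le> of_int (- a) * (x * x :: rat)" "0 \<le> of_int (- b) * (x * x :: rat)"
    "0 \<le> of_int (a * b) * (x * x :: rat)"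
proof -
  have "0 \<le> (of_int (- a) :: rat)" "0 \<le> (of_int (- b) :: rat)" "0 \<le> (of_int (a * b) :: rat)"
    unfolding of_int_0_le_iff using assms by (simp_all add: mult_nonpos_nonpos)
  then show "0 \<le> of_int (- a) * (x * x)" "0 \<le> of_int (- b) * (x * x)" "0 \<le> of_int (a * b) * (x * x)"
    by (simp_all only: mult_nonneg_nonneg zero_le_square)
qed

lemma qnorm_nonneg:
  assumes "a < 0" "b < 0"
  shows "0 \<le> qnorm a b q"
  unfolding qnorm_def using qnorm_terms_nonneg[OF assms] by (intro add_nonneg_nonneg) simp_all

lemma qnorm_eq_0_iff:
  assumes "a < 0" "b < 0"
  shows "qnorm a b q = 0 \<longleftrightarrow> q = \<zero>\<^bsub>quat_alg a b\<^esub>"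
proof
  assume "qnorm a b q = 0"
  then have "qRe q * qRe q = 0 \<and> of_int (- a) * (qI q * qI q) = 0 \<and> of_int (- b) * (qJ q * qJ q) = 0 \<and>
      of_int (a * b) * (qK q * qK q) = 0"
    unfolding qnorm_def using qnorm_terms_nonneg[OF assms, of "qI q"] qnorm_terms_nonneg[OF assms, of "qJ q"]
      qnorm_terms_nonneg[OF assms, of "qK q"] zero_le_square[of "qRe q"] by linarith
  then show "q = \<zero>\<^bsub>quat_alg a b\<^esub>"
    using assms by (cases q) (auto simp: quat_alg_def)
qed (simp add: qnorm_def quat_alg_def)

text \<open>
  This is the parallelogram law for \<open>p = (p - q) + q\<close>, with the nonnegative
  norm of \<open>p - 2 q\<close> dropped. It replaces the triangle inequality, so that no square roots of norms occur.
\<close>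
lemma qnorm_minus:
  assumes "a < 0" "b < 0"
  shows "qnorm a b p \<le> 2 * qnorm a b (p \<ominus>\<^bsub>quat_alg a b\<^esub> q) + 2 * qnorm a b q"
proof -
  \<comment> \<open>the fourth term \<open>p - 2 q\<close> of the parallelogram law\<close>
  define r where "r = Quat (qRe p - 2 * qRe q) (qI p - 2 * qI q) (qJ p - 2 * qJ q) (qK p - 2 * qK q)"
  have "2 * qnorm a b (p \<ominus>\<^bsub>quat_alg a b\<^esub> q) + 2 * qnorm a b q = qnorm a b p + qnorm a b r"
    by (simp add: qnorm_def quat_a_minus r_def algebra_simps)
  then show ?thesis using qnorm_nonneg[OF assms, of r] by simp
qed

lemma lipschitz_qnorm_ge_1:
  assumes "a < 0" "b < 0" "d \<in> lipschitz" "d \<noteq> \<zero>\<^bsub>quat_alg a b\<^esub>"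
  shows "1 \<le> qnorm a b d"
proof -
  have "qnorm a b d \<in> \<int>" using assms(3) by (auto simp: lipschitz_altdef qnorm_def)
  moreover have "0 < qnorm a b d"
    using qnorm_nonneg[OF assms(1,2), of d] qnorm_eq_0_iff[OF assms(1,2), of d] assms(4) by simp
  ultimately show ?thesis by (auto elim!: Ints_cases)
qed

lemma lipschitz_subset: "lipschitz_Z \<subseteq> lipschitz" "lipschitz_Zi \<subseteq> lipschitz" "lipschitz_Zj \<subseteq> lipschitz"
  by (auto simp: lipschitz_altdef lipschitz_Z_def lipschitz_Zi_def lipschitz_Zj_def)

lemma lipschitz_Z_altdef: "lipschitz_Z = {q \<in> lipschitz. qI q = 0 \<and> qJ q = 0 \<and> qK q = 0}"
  and lipschitz_Zi_altdef: "lipschitz_Zi = {q \<in> lipschitz. qJ q = 0 \<and> qK q = 0}"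
  and lipschitz_Zj_altdef: "lipschitz_Zj = {q \<in> lipschitz. qI q = 0 \<and> qK q = 0}"
  by (force simp: lipschitz_def lipschitz_Z_def lipschitz_Zi_def lipschitz_Zj_def)+

lemma subcring_quat_algI:
  assumes "S = {q \<in> lipschitz. P q}" "P (Quat 1 0 0 0)"
    and "\<And>p. P p \<Longrightarrow> P (\<ominus>\<^bsub>quat_alg a b\<^esub> p)"
    and "\<And>p q. \<lbrakk>P p; P q\<rbrakk> \<Longrightarrow> P (p \<oplus>\<^bsub>quat_alg a b\<^esub> q)"
    and "\<And>p q. \<lbrakk>P p; P q\<rbrakk> \<Longrightarrow> P (p \<otimes>\<^bsub>quat_alg a b\<^esub> q)"
    and "\<And>p q. \<lbrakk>P p; P q\<rbrakk> \<Longrightarrow> p \<otimes>\<^bsub>quat_alg a b\<^esub> q = q \<otimes>\<^bsub>quat_alg a b\<^esub> p"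
  shows "subcring S (quat_alg a b)"
proof -
  interpret ring "quat_alg a b" by (rule ring_quat_alg)
  have one: "\<one>\<^bsub>quat_alg a b\<^esub> = Quat 1 0 0 0" and car: "carrier (quat_alg a b) = UNIV"
    by (simp_all add: quat_alg_def)
  note L = subringE[OF subring_lipschitz[of a b]]
  show ?thesis unfolding assms(1)
    by (intro subcringI subringI) (use L assms(2-) in \<open>auto simp: one car\<close>)
qed

lemma subcring_lipschitz_Z: "subcring lipschitz_Z (quat_alg a b)"
  by (rule subcring_quat_algI[OF lipschitz_Z_altdef])
     (simp_all add: quat_a_inv, simp_all add: quat_alg_simps algebra_simps)

lemma subcring_lipschitz_Zi: "subcring lipschitz_Zi (quat_alg a b)"
  by (rule subcring_quat_algI[OF lipschitz_Zi_altdef])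
     (simp_all add: quat_a_inv, simp_all add: quat_alg_simps algebra_simps)

lemma subcring_lipschitz_Zj: "subcring lipschitz_Zj (quat_alg a b)"
  by (rule subcring_quat_algI[OF lipschitz_Zj_altdef])
     (simp_all add: quat_a_inv, simp_all add: quat_alg_simps algebra_simps)

lemma Ints_square_ge_1: "(x :: rat) \<in> \<int> \<Longrightarrow> x \<noteq> 0 \<Longrightarrow> 1 \<le> x * x"
proof -
  assume "x \<in> \<int>" "x \<noteq> 0"
  then have "1 \<le> \<bar>x\<bar>" by (auto elim!: Ints_cases)
  then show ?thesis using mult_mono[of 1 "\<bar>x\<bar>" 1 "\<bar>x\<bar>"] by simp
qed

text \<open>
  The pure part of \<open>q\<close> is nonzero and has norm at least 4, and \<open>A\<close> does not change it.
\<close>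
lemma gap_Z:
  assumes "a \<le> -4" "b \<le> -4" "q \<in> lipschitz" "q \<notin> lipschitz_Z" "D \<in> lipschitz_Z" "A \<in> lipschitz_Z"
  shows "4 * qnorm a b D \<le> qnorm a b (q \<otimes>\<^bsub>quat_alg a b\<^esub> D \<oplus>\<^bsub>quat_alg a b\<^esub> A)"
proof -
  have ab: "a < 0" "b < 0" using assms by auto
  define x y z d where "x = qI q" and "y = qJ q" and "z = qK q" and "d = qRe D"
  have D: "qI D = 0" "qJ D = 0" "qK D = 0" and A: "qI A = 0" "qJ A = 0" "qK A = 0"
    using assms by (auto simp: lipschitz_Z_altdef)
  have int: "x \<in> \<int>" "y \<in> \<int>" "z \<in> \<int>" and nz: "x \<noteq> 0 \<or> y \<noteq> 0 \<or> z \<noteq> 0"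
    using assms by (auto simp: lipschitz_Z_altdef lipschitz_altdef x_def y_def z_def)
  let ?P = "of_int (- a) * (x * x) + of_int (- b) * (y * y) + of_int (a * b) * (z * z)"
  have "4 * 1 \<le> (-a) * (-b)" using assms by (intro mult_mono) auto
  then have ge: "4 \<le> (of_int (- a) :: rat)" "4 \<le> (of_int (- b) :: rat)" "4 \<le> (of_int (a * b) :: rat)"
    using assms by linarith+
  have "4 * (x * x) + 4 * (y * y) + 4 * (z * z) \<le> ?P"
    using ge by (intro add_mono mult_right_mono) simp_all
  moreover have "1 \<le> x * x + y * y + z * z"
    using nz Ints_square_ge_1[OF int(1)] Ints_square_ge_1[OF int(2)] Ints_square_ge_1[OF int(3)]
      zero_le_square[of x] zero_le_square[of y] zero_le_square[of z] by linarith
  ultimately have "4 \<le> ?P" by linarith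
  then have "4 * (d * d) \<le> ?P * (d * d)" by (intro mult_right_mono) auto
  also have "\<dots> \<le> ?P * (d * d) + (qRe q * d + qRe A) * (qRe q * d + qRe A)" by simp
  also have "\<dots> = qnorm a b (q \<otimes>\<^bsub>quat_alg a b\<^esub> D \<oplus>\<^bsub>quat_alg a b\<^esub> A)"
    by (simp add: qnorm_def quat_alg_simps D A x_def y_def z_def d_def algebra_simps)
  finally show ?thesis by (simp add: qnorm_def D d_def)
qed

lemma gap_aux:
  assumes "a < 0" "b \<le> -4" "y \<in> \<int>" "z \<in> \<int>" "y \<noteq> 0 \<or> z \<noteq> 0" "(n::rat) \<ge> 0"
  shows "4 * n \<le> (of_int (- b) * (y * y) + of_int (a * b) * (z * z)) * n"
proof -
  have "1 * 4 \<le> (-a) * (-b)" using assms by (intro mult_mono) auto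
  then have ge: "4 \<le> (of_int (- b) :: rat)" "4 \<le> (of_int (a * b) :: rat)"
    using assms by linarith+
  have "4 * (y * y) + 4 * (z * z) \<le> of_int (- b) * (y * y) + of_int (a * b) * (z * z)"
    using ge by (intro add_mono mult_right_mono) simp_all
  moreover have "1 \<le> y * y + z * z"
    using assms(5) Ints_square_ge_1[OF assms(3)] Ints_square_ge_1[OF assms(4)]
      zero_le_square[of y] zero_le_square[of z] by linarith
  ultimately have "4 \<le> of_int (- b) * (y * y) + of_int (a * b) * (z * z)" by linarith
  then show ?thesis using assms(6) by (intro mult_right_mono) auto
qed

text \<open>
  Right multiplication by an element \<open>D\<close> of \<open>\<int>[i]\<close> preserves the orthogonal decomposition into
  \<open>\<rat> + \<rat> i\<close> and \<open>\<rat> j + \<rat> k\<close>, and adding \<open>A\<close> affects the first part only. The second part of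
  \<open>q\<close> is nonzero and has norm at least 4.
\<close>
lemma gap_Zi:
  assumes "a < 0" "b \<le> -4" "q \<in> lipschitz" "q \<notin> lipschitz_Zi" "D \<in> lipschitz_Zi" "A \<in> lipschitz_Zi"
  shows "4 * qnorm a b D \<le> qnorm a b (q \<otimes>\<^bsub>quat_alg a b\<^esub> D \<oplus>\<^bsub>quat_alg a b\<^esub> A)"
proof -
  have ab: "a < 0" "b < 0" using assms by auto
  have D: "qJ D = 0" "qK D = 0" and A: "qJ A = 0" "qK A = 0"
    using assms by (auto simp: lipschitz_Zi_altdef)
  define X where "X = Quat (qRe q) (qI q) 0 0 \<otimes>\<^bsub>quat_alg a b\<^esub> D \<oplus>\<^bsub>quat_alg a b\<^esub> A"
  have "4 * qnorm a b D \<le> (of_int (- b) * (qJ q * qJ q) + of_int (a * b) * (qK q * qK q)) * qnorm a b D"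
    using assms by (intro gap_aux qnorm_nonneg) (auto simp: lipschitz_Zi_altdef lipschitz_altdef)
  also have "\<dots> \<le> (of_int (- b) * (qJ q * qJ q) + of_int (a * b) * (qK q * qK q)) * qnorm a b D + qnorm a b X"
    using qnorm_nonneg[OF ab, of X] by simp
  also have "\<dots> = qnorm a b (q \<otimes>\<^bsub>quat_alg a b\<^esub> D \<oplus>\<^bsub>quat_alg a b\<^esub> A)"
    by (simp add: qnorm_def quat_alg_simps D A X_def algebra_simps)
  finally show ?thesis .
qed

lemma gap_Zj:
  assumes "a \<le> -4" "b < 0" "q \<in> lipschitz" "q \<notin> lipschitz_Zj" "D \<in> lipschitz_Zj" "A \<in> lipschitz_Zj"
  shows "4 * qnorm a b D \<le> qnorm a b (q \<otimes>\<^bsub>quat_alg a b\<^esub> D \<oplus>\<^bsub>quat_alg a b\<^esub> A)"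
proof -
  have ab: "a < 0" "b < 0" using assms by auto
  have D: "qI D = 0" "qK D = 0" and A: "qI A = 0" "qK A = 0"
    using assms by (auto simp: lipschitz_Zj_altdef)
  define X where "X = Quat (qRe q) 0 (qJ q) 0 \<otimes>\<^bsub>quat_alg a b\<^esub> D \<oplus>\<^bsub>quat_alg a b\<^esub> A"
  have "4 * qnorm a b D \<le> (of_int (- a) * (qI q * qI q) + of_int (b * a) * (qK q * qK q)) * qnorm a b D"
    using assms by (intro gap_aux qnorm_nonneg) (auto simp: lipschitz_Zj_altdef lipschitz_altdef)
  also have "\<dots> \<le> (of_int (- a) * (qI q * qI q) + of_int (b * a) * (qK q * qK q)) * qnorm a b D + qnorm a b X"
    using qnorm_nonneg[OF ab, of X] by simp
  also have "\<dots> = qnorm a b (q \<otimes>\<^bsub>quat_alg a b\<^esub> D \<oplus>\<^bsub>quat_alg a b\<^esub> A)"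
    by (simp add: qnorm_def quat_alg_simps D A X_def algebra_simps)
  finally show ?thesis .
qed

section \<open>Friezes as closed recursions\<close>

context unit_frieze
begin

sublocale frieze_recursion D m strip
proof
  show "strip r s \<in> carrier D" if "r \<le> s" "s \<le> r + m" for r s
    using that entry_nonzero[of r s] by (auto simp: strip_def)
  show "strip r r = \<zero>" "strip r (r + m) = \<zero>" for r
    by (simp_all add: strip_def)
  show "strip r (Suc r) = \<one>" for r
    using three_le entry_boundary by (simp add: strip_def)
  show "strip r s \<noteq> \<zero>" if "r < s" "s < r + m" for r s
    using that entry_nonzero[of r s] by (auto simp: strip_def)
qed (rule strip_recursion)

text \<open>
  If \<open>s < r\<close>, the entry is reached by going on to \<open>s + m\<close>.
\<close>
lemma frieze_entry_in_strip:
  assumes "r < m" "s < m" "r \<noteq> s"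
  obtains s' where "r \<le> s'" "s' \<le> r + m" "c r s = strip r s'"
proof (cases "r < s")
  case True
  then show thesis using that[of s] assms by (simp add: strip_def entry_def)
next
  case False
  then show thesis using that[of "s + m"] assms by (simp add: strip_def entry_def)
qed

end

section \<open>A square and a hexagon\<close>

context division_ring
begin

text \<open>
  The exchange relation across the diagonals reads \<open>x = y\<^sup>-\<^sup>1 + y\<^sup>-\<^sup>1\<close>.
\<close>
lemma square_frieze:
  assumes xy: "x \<in> carrier R - {\<zero>}" "y \<in> carrier R - {\<zero>}"
    and prod: "x \<otimes> y = \<one> \<oplus> \<one>" "y \<otimes> x = \<one> \<oplus> \<one>"
  defines "c \<equiv> \<lambda>r s. if odd (r + s) then \<one> else if even r then x else y"
  shows "nc_frieze R 4 c"
proof -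
  have nz1: "\<one> \<in> carrier R - {\<zero>}" using one_not_zero by simp
  have half: "inv v \<oplus> inv v = u"
    if "u \<in> carrier R" "v \<in> carrier R - {\<zero>}" "u \<otimes> v = \<one> \<oplus> \<one>" for u v
  proof -
    have "inv v \<oplus> inv v = (\<one> \<oplus> \<one>) \<otimes> inv v"
      using that by (simp add: l_distr)
    also have "\<dots> = u \<otimes> v \<otimes> inv v" by (simp only: that(3))
    also have "\<dots> = u" using that(1,2) by (simp add: m_assoc)
    finally show ?thesis .
  qed
  have lt: "r = 0 \<or> r = 1 \<or> r = 2 \<or> r = 3" if "r < 4" for r :: nat using that by linarith
  show ?thesis
  proof
    show "(3::nat) \<le> 4" by simp
    show "c r s \<in> carrier R - {\<zero>}" if "r < 4" "s < 4" "r \<noteq> s" for r s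
      using xy nz1 by (auto simp: c_def)
  next
    fix r r1 r2 :: nat
    assume "r < 4" "r1 = (r + 1) mod 4" "r2 = (r + 2) mod 4"
    then show "c r1 r2 \<otimes> inv (c r r2) \<otimes> c r r1 = c r1 r \<otimes> inv (c r2 r) \<otimes> c r2 r1"
      using xy by (auto dest!: lt simp: c_def)
  next
    fix r s r1 s1 :: nat
    assume "r < 4" "s < 4" "r1 = (r + 1) mod 4" "s1 = (s + 1) mod 4" "distinct [r, r1, s, s1]"
    then show "c s r = c s s1 \<otimes> inv (c r1 s1) \<otimes> c r1 r \<oplus> c s r1 \<otimes> inv (c s1 r1) \<otimes> c s1 r \<and>
         c r s = c r r1 \<otimes> inv (c s1 r1) \<otimes> c s1 s \<oplus> c r s1 \<otimes> inv (c r1 s1) \<otimes> c r1 s \<and>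
         c r1 s1 = c r1 r \<otimes> inv (c s r) \<otimes> c s s1 \<oplus> c r1 s \<otimes> inv (c r s) \<otimes> c r s1 \<and>
         c s1 r1 = c s1 s \<otimes> inv (c r s) \<otimes> c r r1 \<oplus> c s1 r \<otimes> inv (c s r) \<otimes> c s r1"
      using xy half[of x y] half[of y x] prod by (auto dest!: lt simp: c_def)
  qed
qed

text \<open>
  The long diagonals are \<open>2\<close>, as \<open>x y - 1 = 2\<close>. The exchange relations come down to
  \<open>x = y\<^sup>-\<^sup>1 + 2 y\<^sup>-\<^sup>1\<close> and \<open>2 = 1/2 + x (1/2) y\<close>.
\<close>
lemma hexagon_frieze:
  assumes xy: "x \<in> carrier R - {\<zero>}" "y \<in> carrier R - {\<zero>}"
    and prod: "x \<otimes> y = \<one> \<oplus> \<one> \<oplus> \<one>" "y \<otimes> x = \<one> \<oplus> \<one> \<oplus> \<one>"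
    and two: "\<one> \<oplus> \<one> \<noteq> \<zero>"
  defines "c \<equiv> \<lambda>r s. if odd (r + s) then if r + 3 = s \<or> s + 3 = r then \<one> \<oplus> \<one> else \<one>
                      else if even r then x else y"
  shows "nc_frieze R 6 c"
proof -
  define t where "t = \<one> \<oplus> \<one>"
  have t: "t \<in> carrier R - {\<zero>}" using two by (simp add: t_def)
  have c_eq: "c = (\<lambda>r s. if odd (r + s) then if r + 3 = s \<or> s + 3 = r then t else \<one>
                      else if even r then x else y)"
    unfolding c_def t_def ..
  have nz1: "\<one> \<in> carrier R - {\<zero>}" using one_not_zero by simp
  have t_comm: "inv t \<otimes> u = u \<otimes> inv t" if "u \<in> carrier R" for u
  proof -
    have "t \<otimes> u = u \<otimes> t" using that by (simp add: t_def l_distr r_distr)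
    then have "inv t \<otimes> (t \<otimes> u) \<otimes> inv t = inv t \<otimes> (u \<otimes> t) \<otimes> inv t" by simp
    then show ?thesis using that t by (simp add: m_assoc)
  qed
  have third: "inv v \<oplus> inv v \<otimes> t = u" "inv v \<oplus> t \<otimes> inv v = u" "t = inv t \<oplus> u \<otimes> inv t \<otimes> v"
    if uv: "u \<in> carrier R" "v \<in> carrier R - {\<zero>}" "u \<otimes> v = \<one> \<oplus> \<one> \<oplus> \<one>" for u v
  proof -
    have *: "inv v \<oplus> inv v \<oplus> inv v = u"
    proof -
      have "inv v \<oplus> inv v \<oplus> inv v = (\<one> \<oplus> \<one> \<oplus> \<one>) \<otimes> inv v"
        using uv by (simp add: l_distr)
      also have "\<dots> = u \<otimes> v \<otimes> inv v" by (simp only: uv(3))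
      also have "\<dots> = u" using uv(1,2) by (simp add: m_assoc)
      finally show ?thesis .
    qed
    then show "inv v \<oplus> inv v \<otimes> t = u" "inv v \<oplus> t \<otimes> inv v = u"
      using uv by (simp_all add: t_def l_distr r_distr a_assoc)
    have "u \<otimes> inv t \<otimes> v = (t \<oplus> \<one>) \<otimes> inv t"
      using uv t t_comm[of v] by (simp add: m_assoc) (simp add: m_assoc[symmetric] t_def)
    then have "u \<otimes> inv t \<otimes> v = \<one> \<oplus> inv t"
      using t by (simp add: l_distr)
    moreover have "inv t \<oplus> inv t = \<one>"
    proof -
      have "inv t \<oplus> inv t = (\<one> \<oplus> \<one>) \<otimes> inv t" using t by (simp add: l_distr)
      then show ?thesis unfolding t_def[symmetric] using t by simp
    qed
    ultimately show "t = inv t \<oplus> u \<otimes> inv t \<otimes> v"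
      using t by (simp add: a_lcomm[of "inv t"]) (simp add: t_def)
  qed
  note third_simps = third[OF _ xy(2) prod(1)] third[OF _ xy(1) prod(2)]
  have simps: "inv y \<oplus> inv y \<otimes> t = x" "inv y \<oplus> t \<otimes> inv y = x" "inv t \<oplus> x \<otimes> inv t \<otimes> y = t"
     "inv x \<oplus> inv x \<otimes> t = y" "inv x \<oplus> t \<otimes> inv x = y" "inv t \<oplus> y \<otimes> inv t \<otimes> x = t"
    using third_simps xy by auto
  have lt: "r = 0 \<or> r = 1 \<or> r = 2 \<or> r = 3 \<or> r = 4 \<or> r = 5" if "r < 6" for r :: nat
    using that by linarith
  show ?thesis
  proof
    show "(3::nat) \<le> 6" by simp
    show "c r s \<in> carrier R - {\<zero>}" if "r < 6" "s < 6" "r \<noteq> s" for r s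
      using xy nz1 t by (auto simp: c_eq)
  next
    fix r r1 r2 :: nat
    assume r: "r < 6" "r1 = (r + 1) mod 6" "r2 = (r + 2) mod 6"
    show "c r1 r2 \<otimes> inv (c r r2) \<otimes> c r r1 = c r1 r \<otimes> inv (c r2 r) \<otimes> c r2 r1"
      unfolding r(2,3) using lt[OF r(1)] xy by (elim disjE) (simp_all add: c_eq)
  next
    fix r s r1 s1 :: nat
    assume rs: "r < 6" "s < 6" "r1 = (r + 1) mod 6" "s1 = (s + 1) mod 6" "distinct [r, r1, s, s1]"
    show "c s r = c s s1 \<otimes> inv (c r1 s1) \<otimes> c r1 r \<oplus> c s r1 \<otimes> inv (c s1 r1) \<otimes> c s1 r \<and>
         c r s = c r r1 \<otimes> inv (c s1 r1) \<otimes> c s1 s \<oplus> c r s1 \<otimes> inv (c r1 s1) \<otimes> c r1 s \<and>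
         c r1 s1 = c r1 r \<otimes> inv (c s r) \<otimes> c s s1 \<oplus> c r1 s \<otimes> inv (c r s) \<otimes> c r s1 \<and>
         c s1 r1 = c s1 s \<otimes> inv (c r s) \<otimes> c r r1 \<oplus> c s1 r \<otimes> inv (c s r) \<otimes> c s r1"
      using lt[OF rs(1)] lt[OF rs(2)] rs(5) unfolding rs(3,4)
      by (elim disjE) (simp_all add: c_eq xy[simplified] t[simplified] simps)
  qed
qed

end

section \<open>The frieze subring\<close>

text \<open>
  Additive inverses in \<open>generate_ring\<close> are taken relative to the carrier; this moves them from the
  Lipschitz ring to the whole algebra, where they are computed componentwise.
\<close>
lemma frieze_subring_eq: "frieze_subring a b =
    generate_ring (quat_alg a b) (\<Union> {frieze_entries m c | m c. lipschitz_frieze a b m c})"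
proof -
  interpret ring "quat_alg a b" by (rule ring_quat_alg)
  let ?E = "\<Union> {frieze_entries m c | m c. lipschitz_frieze a b m c}"
  have E: "?E \<subseteq> lipschitz" by (auto simp: lipschitz_frieze_def)
  have U: "(quat_alg a b)\<lparr>carrier := carrier (quat_alg a b)\<rparr> = quat_alg a b" by simp
  have E': "?E \<subseteq> carrier (quat_alg a b)" by (simp add: quat_alg_def)
  show ?thesis unfolding frieze_subring_def
    using subring_gen_incl[OF subring_lipschitz carrier_is_subring E E']
      subring_gen_incl[OF carrier_is_subring subring_lipschitz E' E] U by auto
qed


lemma frieze_entry_mem:
  assumes "lipschitz_frieze a b m c" "r < m" "s < m" "r \<noteq> s"
  shows "c r s \<in> frieze_subring a b"
  unfolding frieze_subring_eq
  by (rule generate_ring.incl) (use assms in \<open>auto simp: frieze_entries_def\<close>)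

lemma frieze_subring_least:
  assumes "subring S (quat_alg a b)"
    and "\<And>m c. lipschitz_frieze a b m c \<Longrightarrow> frieze_entries m c \<subseteq> S"
  shows "frieze_subring a b \<subseteq> S"
proof -
  interpret ring "quat_alg a b" by (rule ring_quat_alg)
  show ?thesis unfolding frieze_subring_eq
    by (rule generate_ring_min_subring1[OF _ assms(1)]) (use assms(2) in \<open>auto simp: quat_alg_def\<close>)
qed

lemma subring_frieze_subring: "subring (frieze_subring a b) (quat_alg a b)"
proof -
  interpret ring "quat_alg a b" by (rule ring_quat_alg)
  show ?thesis unfolding frieze_subring_eq
    by (rule generate_ring_is_subring) (auto simp: quat_alg_def)
qed

lemma frieze_subring_subset_lipschitz: "frieze_subring a b \<subseteq> lipschitz"
  by (rule frieze_subring_least[OF subring_lipschitz]) (auto simp: lipschitz_frieze_def)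

lemma frieze_subring_subset:
  assumes ab: "a < 0" "b < 0" and S: "subcring S (quat_alg a b)" "S \<subseteq> lipschitz"
    and gap: "\<And>q D A. \<lbrakk>q \<in> lipschitz; q \<notin> S; D \<in> S; A \<in> S\<rbrakk> \<Longrightarrow>
      4 * qnorm a b D \<le> qnorm a b (q \<otimes>\<^bsub>quat_alg a b\<^esub> D \<oplus>\<^bsub>quat_alg a b\<^esub> A)"
  shows "frieze_subring a b \<subseteq> S"
proof (rule frieze_subring_least)
  show S': "subring S (quat_alg a b)" using S(1) by (rule subcring.axioms)
  fix m c assume frieze: "lipschitz_frieze a b m c"
  interpret unit_frieze "quat_alg a b" m c
    using frieze by (simp add: lipschitz_frieze_def unit_frieze_def unit_frieze_axioms_def)
  interpret normed_frieze_recursion "quat_alg a b" m strip "qnorm a b"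
    by unfold_locales
      (use ab in \<open>simp_all add: qnorm_mult qnorm_nonneg qnorm_eq_0_iff qnorm_minus\<close>)
  have L: "strip i (i + 2) \<in> lipschitz" for i
  proof -
    have "strip i (i + 2) = c (i mod m) ((i + 2) mod m)" using three_le by (simp add: strip_def entry_def)
    moreover have "i mod m \<noteq> (i + 2) mod m" using mod_distinct[of i "i + 2"] three_le by simp
    ultimately have "strip i (i + 2) \<in> frieze_entries m c"
      using mod_less_divisor[of m] three_le unfolding frieze_entries_def by fastforce
    then show ?thesis using frieze by (auto simp: lipschitz_frieze_def)
  qed
  have "strip i (i + 2) \<in> S" for i
    using quiddity_in_subring[OF S(1) _ L gap] lipschitz_qnorm_ge_1[OF ab] S(2) three_le by auto
  then have "strip r s \<in> S" if "r \<le> s" "s \<le> r + m" for r s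
    using C_mem_of_quiddity[OF S'] that three_le by auto
  then have "c r s \<in> S" if "r < m" "s < m" "r \<noteq> s" for r s
    using frieze_entry_in_strip[OF that] by metis
  then show "frieze_entries m c \<subseteq> S"
    by (auto simp: frieze_entries_def)
qed

lemma lipschitz_friezeI:
  assumes "nc_frieze (quat_alg a b) m c"
    and "\<And>r s. \<lbrakk>r < m; s < m; r \<noteq> s\<rbrakk> \<Longrightarrow> c r s \<in> lipschitz - {\<zero>\<^bsub>quat_alg a b\<^esub>}"
    and "\<And>r. r < m \<Longrightarrow> c r ((r + 1) mod m) = \<one>\<^bsub>quat_alg a b\<^esub>"
    and "\<And>r. r < m \<Longrightarrow> c ((r + 1) mod m) r = \<one>\<^bsub>quat_alg a b\<^esub>"
  shows "lipschitz_frieze a b m c"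
proof -
  have "frieze_entries m c \<subseteq> lipschitz - {\<zero>\<^bsub>quat_alg a b\<^esub>}"
  proof
    fix z assume "z \<in> frieze_entries m c"
    then obtain r s where "r < m" "s < m" "r \<noteq> s" "z = c r s"
      unfolding frieze_entries_def by blast
    then show "z \<in> lipschitz - {\<zero>\<^bsub>quat_alg a b\<^esub>}" using assms(2)[of r s] by simp
  qed
  moreover have "boundary_entries m c \<subseteq> {\<one>\<^bsub>quat_alg a b\<^esub>}"
  proof
    fix z assume "z \<in> boundary_entries m c"
    then obtain r where "r < m" "z = c r ((r + 1) mod m) \<or> z = c ((r + 1) mod m) r"
      unfolding boundary_entries_def by blast
    then show "z \<in> {\<one>\<^bsub>quat_alg a b\<^esub>}" using assms(3,4)[of r] by (elim disjE) simp_all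
  qed
  ultimately show ?thesis using assms(1) by (simp only: lipschitz_frieze_def)
qed

lemma quat_two_three:
  shows "\<one>\<^bsub>quat_alg a b\<^esub> \<oplus>\<^bsub>quat_alg a b\<^esub> \<one>\<^bsub>quat_alg a b\<^esub> = Quat 2 0 0 0"
    and "Quat 2 0 0 0 \<oplus>\<^bsub>quat_alg a b\<^esub> \<one>\<^bsub>quat_alg a b\<^esub> = Quat 3 0 0 0"
  by (simp_all add: quat_alg_def)

lemma square_entry_mem:
  assumes ab: "a < 0" "b < 0" and xy: "x \<in> lipschitz" "y \<in> lipschitz"
    and prod: "x \<otimes>\<^bsub>quat_alg a b\<^esub> y = Quat 2 0 0 0" "y \<otimes>\<^bsub>quat_alg a b\<^esub> x = Quat 2 0 0 0"
  shows "x \<in> frieze_subring a b"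
proof -
  interpret division_ring "quat_alg a b" using ab by (rule division_ring_quat_alg)
  define c where "c = (\<lambda>r s::nat. if odd (r + s) then \<one>\<^bsub>quat_alg a b\<^esub> else if even r then x else y)"
  have nz: "x \<noteq> \<zero>\<^bsub>quat_alg a b\<^esub>" "y \<noteq> \<zero>\<^bsub>quat_alg a b\<^esub>"
    using prod by (auto simp: quat_alg_simps)
  have car: "carrier (quat_alg a b) = UNIV" by (simp add: quat_alg_def)
  have nc: "nc_frieze (quat_alg a b) 4 c" unfolding c_def
    by (rule square_frieze[of x y, unfolded quat_two_three]) (use nz prod in \<open>simp_all add: car\<close>)
  have entries: "c r s \<in> lipschitz - {\<zero>\<^bsub>quat_alg a b\<^esub>}" for r s
    using xy nz one_not_zero subringE(3)[OF subring_lipschitz[of a b]] by (simp add: c_def)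
  have boundary: "c r ((r + 1) mod 4) = \<one>\<^bsub>quat_alg a b\<^esub>" "c ((r + 1) mod 4) r = \<one>\<^bsub>quat_alg a b\<^esub>" for r
  proof -
    have "odd (r + (r + 1) mod 4)" "odd ((r + 1) mod 4 + r)" by presburger+
    then show "c r ((r + 1) mod 4) = \<one>\<^bsub>quat_alg a b\<^esub>" "c ((r + 1) mod 4) r = \<one>\<^bsub>quat_alg a b\<^esub>"
      unfolding c_def by (simp_all only: if_True not_False_eq_True)
  qed
  have "lipschitz_frieze a b 4 c"
    by (rule lipschitz_friezeI[OF nc entries boundary])
  from frieze_entry_mem[OF this, of 0 2] show ?thesis by (simp add: c_def)
qed

lemma hexagon_entry_mem:
  assumes ab: "a < 0" "b < 0" and xy: "x \<in> lipschitz" "y \<in> lipschitz"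
    and prod: "x \<otimes>\<^bsub>quat_alg a b\<^esub> y = Quat 3 0 0 0" "y \<otimes>\<^bsub>quat_alg a b\<^esub> x = Quat 3 0 0 0"
  shows "x \<in> frieze_subring a b"
proof -
  interpret division_ring "quat_alg a b" using ab by (rule division_ring_quat_alg)
  define c where "c = (\<lambda>r s::nat. if odd (r + s)
    then if r + 3 = s \<or> s + 3 = r then Quat 2 0 0 0 else \<one>\<^bsub>quat_alg a b\<^esub>
    else if even r then x else y)"
  have nz: "x \<noteq> \<zero>\<^bsub>quat_alg a b\<^esub>" "y \<noteq> \<zero>\<^bsub>quat_alg a b\<^esub>" "Quat 2 0 0 0 \<noteq> \<zero>\<^bsub>quat_alg a b\<^esub>"
    using prod by (auto simp: quat_alg_simps)
  have car: "carrier (quat_alg a b) = UNIV" by (simp add: quat_alg_def)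
  have nc: "nc_frieze (quat_alg a b) 6 c" unfolding c_def
    by (rule hexagon_frieze[of x y, unfolded quat_two_three]) (use nz prod in \<open>simp_all add: car\<close>)
  have entries: "c r s \<in> lipschitz - {\<zero>\<^bsub>quat_alg a b\<^esub>}" for r s
    using xy nz one_not_zero subringE(3)[OF subring_lipschitz[of a b]]
    by (simp add: c_def lipschitz_altdef[THEN equalityD2, THEN subsetD])
  have boundary: "c r ((r + 1) mod 6) = \<one>\<^bsub>quat_alg a b\<^esub>" "c ((r + 1) mod 6) r = \<one>\<^bsub>quat_alg a b\<^esub>"
    if "r < 6" for r
  proof -
    have "odd (r + (r + 1) mod 6)" "odd ((r + 1) mod 6 + r)" by presburger+
    moreover have "\<not> (r + 3 = (r + 1) mod 6 \<or> (r + 1) mod 6 + 3 = r)"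
      "\<not> ((r + 1) mod 6 + 3 = r \<or> r + 3 = (r + 1) mod 6)" using that by presburger+
    ultimately show "c r ((r + 1) mod 6) = \<one>\<^bsub>quat_alg a b\<^esub>" "c ((r + 1) mod 6) r = \<one>\<^bsub>quat_alg a b\<^esub>"
      unfolding c_def by (simp_all only: if_True if_False not_False_eq_True)
  qed
  have "lipschitz_frieze a b 6 c"
    by (rule lipschitz_friezeI[OF nc entries boundary])
  from frieze_entry_mem[OF this, of 0 2] show ?thesis by (simp add: c_def)
qed

lemma int_mem_subring:
  assumes "subring T (quat_alg a b)"
  shows "Quat (of_int n) 0 0 0 \<in> T"
proof (induction n rule: int_induct[where k = 0])
  case base
  show ?case using subringE(2)[OF assms] by (simp add: quat_alg_def)
next
  case (step1 n)
  then show ?case using subringE(7)[OF assms step1(2) subringE(3)[OF assms]] by (simp add: quat_alg_def add.commute)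
next
  case (step2 n)
  then show ?case using subringE(7)[OF assms step2(2) subringE(5)[OF assms subringE(3)[OF assms]]]
    by (simp add: quat_a_inv) (simp add: quat_alg_def)
qed

text \<open>
  For \<open>a = -1\<close> the square with diagonals \<open>1 \<plusminus> i\<close> contributes \<open>1 + i\<close>, for \<open>a = -2\<close> the square with
  diagonals \<open>\<plusminus> i\<close>, and for \<open>a = -3\<close> the hexagon with short diagonals \<open>\<plusminus> i\<close>.
\<close>
lemma i_mem_frieze_subring:
  assumes "a \<in> {-1, -2, -3}" "b < 0"
  shows "Quat 0 1 0 0 \<in> frieze_subring a b"
proof -
  note T = subringE[OF subring_frieze_subring[of a b]]
  consider "a = -1" | "a = -2" | "a = -3" using assms by auto
  then show ?thesis
  proof cases
    case 1
    have "Quat 1 1 0 0 \<in> frieze_subring a b"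
      by (rule square_entry_mem[where y = "Quat 1 (-1) 0 0"])
         (use assms 1 in \<open>auto simp: lipschitz_altdef quat_alg_simps\<close>)
    from T(7)[OF this T(5)[OF T(3)]] show ?thesis
      by (simp add: quat_a_inv) (simp add: quat_alg_def)
  next
    case 2
    show ?thesis
      by (rule square_entry_mem[where y = "Quat 0 (-1) 0 0"])
         (use assms 2 in \<open>auto simp: lipschitz_altdef quat_alg_simps\<close>)
  next
    case 3
    show ?thesis
      by (rule hexagon_entry_mem[where y = "Quat 0 (-1) 0 0"])
         (use assms 3 in \<open>auto simp: lipschitz_altdef quat_alg_simps\<close>)
  qed
qed

lemma j_mem_frieze_subring:
  assumes "b \<in> {-1, -2, -3}" "a < 0"
  shows "Quat 0 0 1 0 \<in> frieze_subring a b"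
proof -
  note T = subringE[OF subring_frieze_subring[of a b]]
  consider "b = -1" | "b = -2" | "b = -3" using assms by auto
  then show ?thesis
  proof cases
    case 1
    have "Quat 1 0 1 0 \<in> frieze_subring a b"
      by (rule square_entry_mem[where y = "Quat 1 0 (-1) 0"])
         (use assms 1 in \<open>auto simp: lipschitz_altdef quat_alg_simps\<close>)
    from T(7)[OF this T(5)[OF T(3)]] show ?thesis
      by (simp add: quat_a_inv) (simp add: quat_alg_def)
  next
    case 2
    show ?thesis
      by (rule square_entry_mem[where y = "Quat 0 0 (-1) 0"])
         (use assms 2 in \<open>auto simp: lipschitz_altdef quat_alg_simps\<close>)
  next
    case 3
    show ?thesis
      by (rule hexagon_entry_mem[where y = "Quat 0 0 (-1) 0"])
         (use assms 3 in \<open>auto simp: lipschitz_altdef quat_alg_simps\<close>)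
  qed
qed

lemma lipschitz_Z_subset_subring:
  assumes "subring T (quat_alg a b)"
  shows "lipschitz_Z \<subseteq> T"
  using int_mem_subring[OF assms] by (auto simp: lipschitz_Z_def)

lemma lipschitz_Zi_subset_subring:
  assumes T: "subring T (quat_alg a b)" and i: "Quat 0 1 0 0 \<in> T"
  shows "lipschitz_Zi \<subseteq> T"
proof
  fix q assume "q \<in> lipschitz_Zi"
  then obtain x y where q: "q = Quat (of_int x) (of_int y) 0 0" by (auto simp: lipschitz_Zi_def)
  have "q = Quat (of_int x) 0 0 0 \<oplus>\<^bsub>quat_alg a b\<^esub> Quat (of_int y) 0 0 0 \<otimes>\<^bsub>quat_alg a b\<^esub> Quat 0 1 0 0"
    by (simp add: q quat_alg_simps)
  then show "q \<in> T" using int_mem_subring[OF T] i subringE(6,7)[OF T] by metis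
qed

lemma lipschitz_Zj_subset_subring:
  assumes T: "subring T (quat_alg a b)" and j: "Quat 0 0 1 0 \<in> T"
  shows "lipschitz_Zj \<subseteq> T"
proof
  fix q assume "q \<in> lipschitz_Zj"
  then obtain x y where q: "q = Quat (of_int x) 0 (of_int y) 0" by (auto simp: lipschitz_Zj_def)
  have "q = Quat (of_int x) 0 0 0 \<oplus>\<^bsub>quat_alg a b\<^esub> Quat (of_int y) 0 0 0 \<otimes>\<^bsub>quat_alg a b\<^esub> Quat 0 0 1 0"
    by (simp add: q quat_alg_simps)
  then show "q \<in> T" using int_mem_subring[OF T] j subringE(6,7)[OF T] by metis
qed

lemma lipschitz_subset_subring:
  assumes T: "subring T (quat_alg a b)" and ij: "Quat 0 1 0 0 \<in> T" "Quat 0 0 1 0 \<in> T"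
  shows "lipschitz \<subseteq> T"
proof
  fix q assume "q \<in> lipschitz"
  then obtain x y z w where q: "q = Quat (of_int x) (of_int y) (of_int z) (of_int w)"
    by (auto simp: lipschitz_def)
  have "q = Quat (of_int x) (of_int y) 0 0 \<oplus>\<^bsub>quat_alg a b\<^esub>
      Quat (of_int z) (of_int w) 0 0 \<otimes>\<^bsub>quat_alg a b\<^esub> Quat 0 0 1 0"
    by (simp add: q quat_alg_simps)
  moreover have "Quat (of_int x) (of_int y) 0 0 \<in> T" for x y
    using lipschitz_Zi_subset_subring[OF T ij(1)] by (auto simp: lipschitz_Zi_def)
  ultimately show "q \<in> T" using ij subringE(6,7)[OF T] by metis
qed

theorem theorem6p6:
  fixes a b :: int
  assumes "a < 0" and "b < 0"
  shows "(a \<le> -4 \<and> b \<le> -4 \<longrightarrow> frieze_subring a b = lipschitz_Z) \<and>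
         (a \<ge> -3 \<and> b \<ge> -3 \<longrightarrow> frieze_subring a b = lipschitz) \<and>
         (a \<in> {-1, -2, -3} \<and> b \<le> -4 \<longrightarrow> frieze_subring a b = lipschitz_Zi) \<and>
         (a \<le> -4 \<and> b \<in> {-1, -2, -3} \<longrightarrow> frieze_subring a b = lipschitz_Zj)"
proof (intro conjI impI; rule equalityI)
  note T = subring_frieze_subring[of a b]
  show "lipschitz_Z \<subseteq> frieze_subring a b" by (rule lipschitz_Z_subset_subring[OF T])
  show "frieze_subring a b \<subseteq> lipschitz" by (rule frieze_subring_subset_lipschitz)
  show "frieze_subring a b \<subseteq> lipschitz_Z" if "a \<le> -4 \<and> b \<le> -4"
    using that by (intro frieze_subring_subset assms subcring_lipschitz_Z lipschitz_subset gap_Z) auto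
  show "frieze_subring a b \<subseteq> lipschitz_Zi" if "a \<in> {-1, -2, -3} \<and> b \<le> -4"
    using that by (intro frieze_subring_subset assms subcring_lipschitz_Zi lipschitz_subset gap_Zi) auto
  show "frieze_subring a b \<subseteq> lipschitz_Zj" if "a \<le> -4 \<and> b \<in> {-1, -2, -3}"
    using that by (intro frieze_subring_subset assms subcring_lipschitz_Zj lipschitz_subset gap_Zj) auto
  show "lipschitz \<subseteq> frieze_subring a b" if "a \<ge> -3 \<and> b \<ge> -3"
  proof (rule lipschitz_subset_subring[OF T])
    have "a \<in> {-1, -2, -3}" "b \<in> {-1, -2, -3}" using that assms by auto
    then show "Quat 0 1 0 0 \<in> frieze_subring a b" "Quat 0 0 1 0 \<in> frieze_subring a b"
      using i_mem_frieze_subring j_mem_frieze_subring assms by auto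
  qed
  show "lipschitz_Zi \<subseteq> frieze_subring a b" if "a \<in> {-1, -2, -3} \<and> b \<le> -4"
    using that assms by (intro lipschitz_Zi_subset_subring[OF T] i_mem_frieze_subring) auto
  show "lipschitz_Zj \<subseteq> frieze_subring a b" if "a \<le> -4 \<and> b \<in> {-1, -2, -3}"
    using that assms by (intro lipschitz_Zj_subset_subring[OF T] j_mem_frieze_subring) auto
qed

end
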